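(* Let $Q$ be in the Frobenius normal form described in the context, let $(X_i)$ be the associated absorbed Markov chain with initial distribution $\pi$ and absorption time $T$, and assume: (A1) for all $i\in\{1,\dots,k\}$ with $\rho_i<\rho_{\max}$, the diagonal block $Q_{ii}$ is scalar; (A2) there is $\theta\in\mathcal{P}_{\max}$ with $\alpha_\theta\neq0$ and $\pi_{\theta_1}v_{\theta_1}\neq0$. Let $\ell\in\{1,\dots,k\}$ with $\rho_\ell=\rho_{\max}$ and $\mathcal{P}^{(\ell)}_{\max}\neq\emptyset$. Then for all $s\in I_\ell$, with $t(s):=s-\sum_{i=1}^{\ell-1}d_i$, \[ \lim_{n\to\infty}\mathbb{E}_\pi\Big[\tfrac{1}{n+1}\#\{m\in\{0,\dots,n\}:X_m=s\}\,\Big|\,T>n\Big]=u^{(\ell)}_{t(s)}v^{(\ell)}_{t(s)}\,\frac{1}{h^+_{\max}}\,\frac{\sum_{\theta\in\mathcal{P}^{(\ell)}_{\max}}\alpha_\theta\pi_{\theta_1}v_{\theta_1}\prod_{u\in H^-(\theta)}\frac{1}{\rho_{\max}-\rho_{\theta_u}}}{\sum_{\theta\in\mathcal{P}_{\max}}\alpha_\theta\pi_{\theta_1}v_{\theta_1}\prod_{u\in H^-(\theta)}\frac{1}{\rho_{\max}-\rho_{\theta_u}}}, \] where $u^{(\ell)\top}=(u^{(\ell)}_1,\dots,u^{(\ell)}_{d_\ell})$ and $v^{(\ell)}=(v^{(\ell)}_1,\dots,v^{(\ell)}_{d_\ell})^\top$ are the positive left and right eigenvectors of $Q_{\ell\ell}$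 for $\rho_\ell$ normalised by $\sum_{i=1}^{d_\ell}v^{(\ell)}_i=1$ and $u^{(\ell)\top}v^{(\ell)}=1$.
   Context: Let $d\ge2$, $P=\begin{pmatrix}1&0\\R&Q\end{pmatrix}$ a stochastic $(d+1)\times(d+1)$ matrix with $R\in\mathbb{R}^{d\times1}$, $Q\in\mathbb{R}^{d\times d}$, $R,Q\ne0$, all eigenvalues of $Q$ of modulus $<1$. $(X_i)_{i\in\mathbb{N}_0}$ is the Markov chain with transition matrix $P$ (state $0$ absorbing), initial distribution $\pi$ on $\{1,\dots,d\}$, $T=\min\{i:X_i=0\}$. $Q$ is in Frobenius normal form: block lower triangular with blocks $Q_{ij}\in\mathbb{R}^{d_i\times d_j}$, $i,j\in\{1,\dots,k\}$, $Q_{ij}=0$ for $j>i$, each $Q_{ii}$ eventually positive with Perron--Frobenius eigenvalue $\rho_i$; $I_j=\{1+\sum_{i<j}d_i,\dots,\sum_{i\le j}d_i\}$; $\pi=(\pi_1,\dots,\pi_k)$ with $\pi_i\in\mathbb{R}^{1\times d_i}$. $v_i$ is a fixed normed positive right eigenvector of $Q_{ii}$ for $\rho_i$ ($v_i=1$ if $d_i=1$), $V_i^-$ the sum of the generalised eigenspaces of $Q_{ii}$ for its other eigenvalues. Admissible path: strictly decreasing $\theta=(\theta_1,\dots,\theta_\kappa)$ in $\{1,\dots,k\}$ with $Q_{\theta_u\theta_{u+1}}\ne0$ for $u<\kappa$; $\mathcal{P}$ the set of them, $\mathcal{P}^{(\ell)}$ those containing $\ell$. $\rho(\theta)=\max_u\rho_{\theta_u}$,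 $H^+(\theta)=\{u:\rho_{\theta_u}=\rho(\theta)\}$, $H^-(\theta)=\{u:\rho_{\theta_u}<\rho(\theta)\}$, $h^+(\theta)=\#H^+(\theta)$. $\rho_{\max}=\max_i\rho_i$, $h^+_{\max}=\max\{h^+(\theta):\theta\in\mathcal{P},\rho(\theta)=\rho_{\max}\}$, $\mathcal{P}_{\max}=\{\theta\in\mathcal{P}:h^+(\theta)=h^+_{\max},\rho(\theta)=\rho_{\max}\}$, $\mathcal{P}^{(\ell)}_{\max}=\mathcal{P}^{(\ell)}\cap\mathcal{P}_{\max}$. $\alpha_\theta=\alpha_{\theta_\kappa}\cdots\alpha_{\theta_1}$, where $\mathbf1=\alpha_{\theta_\kappa}v_{\theta_\kappa}+w_{\theta_\kappa}$ with $w_{\theta_\kappa}\in V^-_{\theta_\kappa}$ ($\mathbf1$ all-ones) and, for $u=\kappa-1,\dots,1$, $Q_{\theta_u\theta_{u+1}}v_{\theta_{u+1}}=\alpha_{\theta_u}v_{\theta_u}+w_{\theta_u}$ with $w_{\theta_u}\in V^-_{\theta_u}$. *)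

theory Defs
  imports Complex_Main "Jordan_Normal_Form.Spectral_Radius"
begin

(* Blocks are numbered 1..k (as in the paper); block sizes ds i.
   Matrices / vectors of Jordan_Normal_Form are 0-indexed: the paper's state s in {1..d}
   of the transient part corresponds to row/column s-1 of Q. *)

definition off :: "(nat \<Rightarrow> nat) \<Rightarrow> nat \<Rightarrow> nat" where
  "off ds j = (\<Sum>i\<in>{1..<j}. ds i)"

definition blk :: "real mat \<Rightarrow> (nat \<Rightarrow> nat) \<Rightarrow> nat \<Rightarrow> nat \<Rightarrow> real mat" where
  "blk Q ds i j = mat (ds i) (ds j) (\<lambda>(a,b). Q $$ (off ds i + a, off ds j + b))"

definition cmat :: "real mat \<Rightarrow> complex mat" where
  "cmat A = map_mat complex_of_real A"

definition cvec :: "real vec \<Rightarrow> complex vec" where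
  "cvec x = map_vec complex_of_real x"

definition eventually_positive :: "real mat \<Rightarrow> bool" where
  "eventually_positive A \<longleftrightarrow>
     (\<exists>m0. \<forall>m\<ge>m0. \<forall>a<dim_row A. \<forall>b<dim_col A. (A ^\<^sub>m m) $$ (a,b) > 0)"

definition PF_eig :: "real mat \<Rightarrow> (nat \<Rightarrow> nat) \<Rightarrow> nat \<Rightarrow> real" where
  "PF_eig Q ds i = spectral_radius (cmat (blk Q ds i i))"

definition gen_eigenspace :: "complex mat \<Rightarrow> complex \<Rightarrow> complex vec set" where
  "gen_eigenspace A \<mu> = {x \<in> carrier_vec (dim_row A).
     \<exists>m. ((A - \<mu> \<cdot>\<^sub>m 1\<^sub>m (dim_row A)) ^\<^sub>m m) *\<^sub>v x = 0\<^sub>v (dim_row A)}"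

definition other_gen_eigenspaces :: "complex mat \<Rightarrow> complex \<Rightarrow> complex vec set" where
  "other_gen_eigenspaces A \<rho> = {x \<in> carrier_vec (dim_row A).
     \<exists>f. (\<forall>\<mu>. f \<mu> \<in> gen_eigenspace A \<mu>) \<and>
         (\<forall>j<dim_row A. x $ j = (\<Sum>\<mu>\<in>{\<mu>. eigenvalue A \<mu> \<and> \<mu> \<noteq> \<rho>}. f \<mu> $ j))}"

definition Vminus :: "real mat \<Rightarrow> (nat \<Rightarrow> nat) \<Rightarrow> nat \<Rightarrow> complex vec set" where
  "Vminus Q ds i = other_gen_eigenspaces (cmat (blk Q ds i i)) (complex_of_real (PF_eig Q ds i))"

definition coef :: "real mat \<Rightarrow> (nat \<Rightarrow> nat) \<Rightarrow> (nat \<Rightarrow> real vec) \<Rightarrow> nat \<Rightarrow> real vec \<Rightarrow> real" where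
  "coef Q ds v i x = (THE a::real. \<exists>w\<in>Vminus Q ds i.
      cvec x = complex_of_real a \<cdot>\<^sub>v cvec (v i) + w)"

(* admissible paths theta = [theta_1, ..., theta_kappa] (list positions are 0-based) *)
definition admissible :: "real mat \<Rightarrow> (nat \<Rightarrow> nat) \<Rightarrow> nat \<Rightarrow> nat list \<Rightarrow> bool" where
  "admissible Q ds k \<theta> \<longleftrightarrow> \<theta> \<noteq> [] \<and> sorted_wrt (>) \<theta> \<and> set \<theta> \<subseteq> {1..k} \<and>
     (\<forall>u. Suc u < length \<theta> \<longrightarrow>
        blk Q ds (\<theta>!u) (\<theta>!Suc u) \<noteq> 0\<^sub>m (ds (\<theta>!u)) (ds (\<theta>!Suc u)))"

definition adm_paths :: "real mat \<Rightarrow> (nat \<Rightarrow> nat) \<Rightarrow> nat \<Rightarrow> nat list set" where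
  "adm_paths Q ds k = {\<theta>. admissible Q ds k \<theta>}"

definition rho_path :: "real mat \<Rightarrow> (nat \<Rightarrow> nat) \<Rightarrow> nat list \<Rightarrow> real" where
  "rho_path Q ds \<theta> = Max ((\<lambda>i. PF_eig Q ds i) ` set \<theta>)"

definition Hplus :: "real mat \<Rightarrow> (nat \<Rightarrow> nat) \<Rightarrow> nat list \<Rightarrow> nat set" where
  "Hplus Q ds \<theta> = {u. u < length \<theta> \<and> PF_eig Q ds (\<theta>!u) = rho_path Q ds \<theta>}"

definition Hminus :: "real mat \<Rightarrow> (nat \<Rightarrow> nat) \<Rightarrow> nat list \<Rightarrow> nat set" where
  "Hminus Q ds \<theta> = {u. u < length \<theta> \<and> PF_eig Q ds (\<theta>!u) < rho_path Q ds \<theta>}"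

definition rho_max :: "real mat \<Rightarrow> (nat \<Rightarrow> nat) \<Rightarrow> nat \<Rightarrow> real" where
  "rho_max Q ds k = Max ((\<lambda>i. PF_eig Q ds i) ` {1..k})"

definition hplus_max :: "real mat \<Rightarrow> (nat \<Rightarrow> nat) \<Rightarrow> nat \<Rightarrow> nat" where
  "hplus_max Q ds k = Max {card (Hplus Q ds \<theta>) | \<theta>.
      \<theta> \<in> adm_paths Q ds k \<and> rho_path Q ds \<theta> = rho_max Q ds k}"

definition Pmax :: "real mat \<Rightarrow> (nat \<Rightarrow> nat) \<Rightarrow> nat \<Rightarrow> nat list set" where
  "Pmax Q ds k = {\<theta> \<in> adm_paths Q ds k. card (Hplus Q ds \<theta>) = hplus_max Q ds k \<and>
                                      rho_path Q ds \<theta> = rho_max Q ds k}"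

definition alpha_path :: "real mat \<Rightarrow> (nat \<Rightarrow> nat) \<Rightarrow> (nat \<Rightarrow> real vec) \<Rightarrow> nat list \<Rightarrow> real" where
  "alpha_path Q ds v \<theta> =
     coef Q ds v (last \<theta>) (vec (ds (last \<theta>)) (\<lambda>_. 1)) *
     (\<Prod>u<length \<theta> - 1. coef Q ds v (\<theta>!u) (blk Q ds (\<theta>!u) (\<theta>!Suc u) *\<^sub>v v (\<theta>!Suc u)))"

definition piv :: "(nat \<Rightarrow> nat) \<Rightarrow> real vec \<Rightarrow> (nat \<Rightarrow> real vec) \<Rightarrow> nat \<Rightarrow> real" where
  "piv ds \<pi> v i = (\<Sum>a<ds i. \<pi> $ (off ds i + a) * v i $ a)"

definition path_weight :: "real mat \<Rightarrow> (nat \<Rightarrow> nat) \<Rightarrow> nat \<Rightarrow> real vec \<Rightarrow> (nat \<Rightarrow> real vec)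
    \<Rightarrow> nat list \<Rightarrow> real" where
  "path_weight Q ds k \<pi> v \<theta> = alpha_path Q ds v \<theta> * piv ds \<pi> v (hd \<theta>) *
     (\<Prod>u\<in>Hminus Q ds \<theta>. 1 / (rho_max Q ds k - PF_eig Q ds (\<theta>!u)))"

(* The Markov chain on {0,...,d} with transition matrix P = [[1,0],[R,Q]] *)
definition trans :: "real mat \<Rightarrow> real vec \<Rightarrow> nat \<Rightarrow> nat \<Rightarrow> real" where
  "trans Q R s s' = (if s = 0 then (if s' = 0 then 1 else 0)
                     else if s' = 0 then R $ (s - 1) else Q $$ (s - 1, s' - 1))"

definition init_dist :: "real vec \<Rightarrow> nat \<Rightarrow> real" where
  "init_dist \<pi> s = (if s = 0 then 0 else \<pi> $ (s - 1))"

definition path_prob :: "real mat \<Rightarrow> real vec \<Rightarrow> real vec \<Rightarrow> nat list \<Rightarrow> real" where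
  "path_prob Q R \<pi> xs = init_dist \<pi> (hd xs) *
      (\<Prod>i<length xs - 1. trans Q R (xs!i) (xs!Suc i))"

definition traj :: "nat \<Rightarrow> nat \<Rightarrow> nat list set" where
  "traj d n = {xs. length xs = Suc n \<and> set xs \<subseteq> {0..d}}"

(* E_pi[ (1/(n+1)) #{m <= n. X_m = s} | T > n ],  where T > n iff X_0,...,X_n are all nonzero *)
definition cond_occupation :: "real mat \<Rightarrow> real vec \<Rightarrow> real vec \<Rightarrow> nat \<Rightarrow> nat \<Rightarrow> nat \<Rightarrow> real" where
  "cond_occupation Q R \<pi> d n s =
     (\<Sum>xs\<in>traj d n. if 0 \<notin> set xs
        then path_prob Q R \<pi> xs * (real (card {m. m \<le> n \<and> xs!m = s}) / real (Suc n)) else 0) /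
     (\<Sum>xs\<in>traj d n. if 0 \<notin> set xs then path_prob Q R \<pi> xs else 0)"

end

theory Submission
  imports Defs "HOL-Computational_Algebra.Formal_Power_Series"
begin

text \<open>
  Divide \<open>Q\<close> by its largest Perron root and encode the powers of a matrix by their generating function, the
  resolvent. Decomposing a trajectory according to the blocks it visits writes the resolvent of a block
  triangular matrix as a sum over admissible paths of products of resolvents of diagonal blocks. By
  Perron--Frobenius the resolvent of a maximal block has a simple pole at \<open>z = 1\<close> with the rank one
  coefficient \<open>v u\<^sup>T\<close>, and that of a scalar block with a smaller root is regular there. Hence a path with \<open>h\<close>
  maximal blocks contributes a pole of order \<open>h\<close>. Its coefficient is the path weight, because \<open>V\<^sup>-\<close> is the
  annihilator of the left Perron vector \<open>u\<close>, so that the \<open>\<alpha>\<close>'s are scalar products with \<open>u\<close>.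

  The expected number of visits to \<open>s\<close> before time \<open>n\<close> is a convolution: reach \<open>s\<close>, then survive from \<open>s\<close>. A path
  ending in the block \<open>l\<close> of \<open>s\<close> and a path starting there glue to a path through \<open>l\<close> on which \<open>l\<close> is counted
  once instead of twice, so the pole has order \<open>h + 1\<close> and coefficient \<open>u s * v s\<close> times the weight of the glued
  path. Comparing \<open>n ^ h / fact h\<close> with \<open>n ^ (h - 1) / fact (h - 1)\<close> yields the factor \<open>1 / h\<close>.
\<close>

section \<open>Power series with a pole at one\<close>

definition multichoose :: "nat \<Rightarrow> nat \<Rightarrow> real" where
  "multichoose p n = real ((n + p - 1) choose n)"

abbreviation geometric :: "real fps" where
  "geometric \<equiv> Abs_fps (\<lambda>_. 1)"

lemma multichoose_Suc: "multichoose (Suc p) n = real ((p + n) choose n)"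
  by (simp add: multichoose_def add.commute)

lemma multichoose_Suc_pos: "multichoose (Suc p) n > 0"
  by (simp add: multichoose_Suc)

lemma sum_multichoose: "(\<Sum>m\<le>n. multichoose p m) = multichoose (Suc p) n"
proof (cases p)
  case 0
  have "(\<Sum>m\<le>n. multichoose 0 m) = (\<Sum>m\<in>{0}. multichoose 0 m)"
    by (rule sum.mono_neutral_right) (auto simp: multichoose_def)
  then show ?thesis by (simp add: 0 multichoose_def)
next
  case (Suc r)
  have "(\<Sum>m\<le>n. multichoose (Suc r) m) = real (\<Sum>m\<le>n. (r + m) choose m)"
    by (simp add: multichoose_Suc)
  also have "\<dots> = real (Suc (r + n) choose n)" by (simp only: sum_choose_lower)
  finally show ?thesis using Suc by (simp add: multichoose_Suc)
qed

lemma fps_nth_geometric_power: "fps_nth (geometric ^ p) n = multichoose p n"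
proof (induction p arbitrary: n)
  case 0
  then show ?case by (simp add: multichoose_def)
next
  case (Suc p)
  have "fps_nth (geometric ^ Suc p) n = fps_nth (geometric ^ p * geometric) n"
    by (simp add: mult.commute)
  then show ?case by (simp add: fps_mult_nth atLeast0AtMost Suc.IH sum_multichoose)
qed

lemma mono_multichoose_Suc: "mono (multichoose (Suc p))"
  by (intro incseq_SucI) (simp add: multichoose_Suc)

lemma multichoose_ratio:
  "multichoose (Suc (Suc p)) n / multichoose (Suc p) n = real (Suc (p + n)) / real (Suc p)"
proof -
  have "Suc (p + n) * ((p + n) choose p) = (Suc (p + n) choose Suc p) * Suc p"
    by (rule Suc_times_binomial_eq)
  moreover have "(p + n) choose p = (p + n) choose n" "Suc (p + n) choose Suc p = Suc (p + n) choose n"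
    using binomial_symmetric[of p "p + n"] binomial_symmetric[of "Suc p" "Suc (p + n)"] by simp_all
  ultimately have "real (Suc (p + n)) * multichoose (Suc p) n = multichoose (Suc (Suc p)) n * real (Suc p)"
    unfolding multichoose_Suc of_nat_mult[symmetric] by simp
  then show ?thesis
    using multichoose_Suc_pos[of p n] by (simp add: field_simps del: of_nat_Suc)
qed

lemma multichoose_step:
  "multichoose (Suc p) n / multichoose (Suc p) (Suc n) = real (Suc n) / real (Suc (p + n))"
proof -
  have "real (Suc (p + n)) * multichoose (Suc p) n = multichoose (Suc p) (Suc n) * real (Suc n)"
    unfolding multichoose_Suc of_nat_mult[symmetric]
    using Suc_times_binomial_eq[of "p + n" n] by simp
  then show ?thesis
    using multichoose_Suc_pos[of p "Suc n"] by (simp add: field_simps del: of_nat_Suc)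
qed

lemma multichoose_ratio_tendsto_0:
  "(\<lambda>n. multichoose (Suc p) n / multichoose (Suc (Suc p)) n) \<longlonglongrightarrow> 0"
proof -
  have "(\<lambda>n. real (Suc p) / real (n + Suc p)) \<longlonglongrightarrow> 0"
    by (rule LIMSEQ_ignore_initial_segment[OF lim_const_over_n])
  also have "(\<lambda>n. real (Suc p) / real (n + Suc p))
      = (\<lambda>n. inverse (multichoose (Suc (Suc p)) n / multichoose (Suc p) n))"
    by (simp add: multichoose_ratio add.commute)
  finally show ?thesis by simp
qed

lemma multichoose_step_tendsto_1:
  "(\<lambda>n. multichoose (Suc p) n / multichoose (Suc p) (Suc n)) \<longlonglongrightarrow> 1"
proof -
  have "(\<lambda>n. 1 - real p / real (n + Suc p)) \<longlonglongrightarrow> 1 - 0"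
    by (intro tendsto_diff tendsto_const LIMSEQ_ignore_initial_segment[OF lim_const_over_n])
  also have "(\<lambda>n. 1 - real p / real (n + Suc p)) = (\<lambda>n. multichoose (Suc p) n / multichoose (Suc p) (Suc n))"
    by (simp add: multichoose_step fun_eq_iff field_simps)
  finally show ?thesis by simp
qed

text \<open>\<open>F\<close> behaves like \<open>c / (1 - z) ^ p\<close> near \<open>z = 1\<close>; absolute convergence at \<open>z = 1\<close> makes the
  case \<open>p = 0\<close> stable under products.\<close>
definition pole_growth :: "nat \<Rightarrow> real \<Rightarrow> real fps \<Rightarrow> bool" where
  "pole_growth p c F \<longleftrightarrow> (case p of
       0 \<Rightarrow> summable (\<lambda>n. \<bar>fps_nth F n\<bar>) \<and> suminf (fps_nth F) = c
     | Suc r \<Rightarrow> (\<lambda>n. fps_nth F n / multichoose p n) \<longlonglongrightarrow> c)"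

lemma pole_growth_0: "pole_growth 0 c F \<longleftrightarrow> summable (\<lambda>n. \<bar>fps_nth F n\<bar>) \<and> suminf (fps_nth F) = c"
  and pole_growth_Suc: "pole_growth (Suc r) c F \<longleftrightarrow> (\<lambda>n. fps_nth F n / multichoose (Suc r) n) \<longlonglongrightarrow> c"
  by (simp_all add: pole_growth_def)

lemma pole_growth_zero: "pole_growth p 0 0"
proof (cases p)
  case 0
  have "fps_nth 0 = (\<lambda>_. 0 :: real)" by auto
  then show ?thesis using 0 by (simp add: pole_growth_0)
qed (simp add: pole_growth_Suc)

lemma pole_growth_add:
  assumes "pole_growth p c F" "pole_growth p d G"
  shows "pole_growth p (c + d) (F + G)"
proof (cases p)
  case 0
  then have FG: "summable (\<lambda>n. \<bar>fps_nth F n\<bar>)" "summable (\<lambda>n. \<bar>fps_nth G n\<bar>)"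
    and sums: "suminf (fps_nth F) = c" "suminf (fps_nth G) = d"
    using assms by (auto simp: pole_growth_0)
  have "summable (\<lambda>n. \<bar>fps_nth (F + G) n\<bar>)"
    by (rule summable_comparison_test'[OF summable_add[OF FG], where N = 0]) auto
  moreover have "fps_nth (F + G) = (\<lambda>n. fps_nth F n + fps_nth G n)" by auto
  then have "suminf (fps_nth (F + G)) = c + d"
    using suminf_add[OF FG[THEN summable_rabs_cancel]] sums by simp
  ultimately show ?thesis using 0 by (simp add: pole_growth_0)
next
  case (Suc r)
  then show ?thesis
    using assms by (auto simp: pole_growth_Suc add_divide_distrib intro: tendsto_add)
qed

lemma pole_growth_cmult:
  assumes "pole_growth p c F"
  shows "pole_growth p (b * c) (fps_const b * F)"
proof (cases p)
  case 0
  have "fps_nth (fps_const b * F) = (\<lambda>n. b * fps_nth F n)" by auto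
  then show ?thesis
    using 0 assms by (auto simp: pole_growth_0 abs_mult suminf_mult summable_rabs_cancel)
next
  case (Suc r)
  then show ?thesis
    using assms tendsto_mult_left[of _ c _ b] by (fastforce simp: pole_growth_Suc)
qed

lemma pole_growth_sum:
  assumes "\<And>j. j \<in> J \<Longrightarrow> pole_growth p (c j) (F j)"
  shows "pole_growth p (\<Sum>j\<in>J. c j) (\<Sum>j\<in>J. F j)"
  using assms
  by (induction J rule: infinite_finite_induct) (auto intro: pole_growth_zero pole_growth_add)

lemma pole_growth_fps_X_mult:
  assumes "pole_growth p c F"
  shows "pole_growth p c (fps_X * F)"
proof (cases p)
  case 0
  then have F: "summable (\<lambda>n. \<bar>fps_nth F n\<bar>)" "suminf (fps_nth F) = c"
    using assms by (auto simp: pole_growth_0)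
  have "fps_nth F sums c"
    using summable_sums[OF summable_rabs_cancel[OF F(1)]] F(2) by simp
  then have "fps_nth (fps_X * F) sums c"
    using sums_Suc[of "fps_nth (fps_X * F)" c] by simp
  moreover have "summable (\<lambda>n. \<bar>fps_nth (fps_X * F) n\<bar>)"
    using summable_Suc_iff[of "\<lambda>n. \<bar>fps_nth (fps_X * F) n\<bar>"] F(1) by simp
  ultimately show ?thesis using 0 by (simp add: pole_growth_0 sums_iff)
next
  case (Suc r)
  have "(\<lambda>n. fps_nth F n / multichoose (Suc r) n * (multichoose (Suc r) n / multichoose (Suc r) (Suc n)))
      \<longlonglongrightarrow> c * 1"
    using assms Suc by (intro tendsto_mult multichoose_step_tendsto_1) (simp add: pole_growth_Suc)
  then have "(\<lambda>n. fps_nth (fps_X * F) (Suc n) / multichoose (Suc r) (Suc n)) \<longlonglongrightarrow> c"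
    using multichoose_Suc_pos[of r] by (simp add: less_imp_neq[symmetric])
  then show ?thesis
    unfolding Suc pole_growth_Suc by (rule LIMSEQ_imp_Suc)
qed

lemma pole_growth_Suc_order:
  assumes "pole_growth p c F"
  shows "pole_growth (Suc p) 0 F"
proof (cases p)
  case 0
  then have "summable (fps_nth F)"
    using assms by (auto simp: pole_growth_0 intro: summable_rabs_cancel)
  then show ?thesis
    using 0 by (simp add: pole_growth_Suc multichoose_Suc summable_LIMSEQ_zero)
next
  case (Suc r)
  have "(\<lambda>n. fps_nth F n / multichoose p n * (multichoose p n / multichoose (Suc p) n)) \<longlonglongrightarrow> c * 0"
    using assms unfolding Suc by (intro tendsto_mult multichoose_ratio_tendsto_0) (simp add: pole_growth_Suc)
  moreover have "fps_nth F n / multichoose p n * (multichoose p n / multichoose (Suc p) n)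
      = fps_nth F n / multichoose (Suc p) n" for n
    using multichoose_Suc_pos[of r n] Suc by simp
  ultimately show ?thesis unfolding pole_growth_Suc by (simp only: mult_zero_right)
qed

lemma pole_growth_higher_order:
  assumes "pole_growth p c F" "p < q"
  shows "pole_growth q 0 F"
proof -
  from \<open>p < q\<close> have "Suc p \<le> q" by simp
  then show ?thesis
    by (induction rule: dec_induct) (auto intro: pole_growth_Suc_order assms(1))
qed

lemma pole_growth_top_order:
  assumes "pole_growth p c F" "p \<le> q"
  shows "pole_growth q (if p = q then c else 0) F"
  using assms pole_growth_higher_order by auto

lemma pole_growth_geometric:
  assumes "\<bar>r\<bar> < 1"
  shows "pole_growth 0 (1 / (1 - r)) (Abs_fps (\<lambda>n. r ^ n))"
  using assms geometric_sums[of r] summable_geometric[of "\<bar>r\<bar>"]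
  by (simp add: pole_growth_0 sums_iff power_abs fps_nth_Abs_fps[abs_def])

lemma silverman_toeplitz_null:
  fixes w :: "nat \<Rightarrow> nat \<Rightarrow> real"
  assumes columns: "\<And>j. (\<lambda>n. w n j) \<longlonglongrightarrow> 0"
    and bounded: "\<And>n. (\<Sum>j\<le>n. \<bar>w n j\<bar>) \<le> K" and t: "t \<longlonglongrightarrow> 0"
  shows "(\<lambda>n. \<Sum>j\<le>n. w n j * t j) \<longlonglongrightarrow> 0"
proof (rule LIMSEQ_I)
  fix \<epsilon> :: real assume "\<epsilon> > 0"
  have "K \<ge> 0" using order_trans[OF sum_nonneg bounded[of 0]] by simp
  define \<delta> where "\<delta> = \<epsilon> / (2 * (K + 1))"
  have "\<delta> > 0" "K * \<delta> < \<epsilon> / 2"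
    using \<open>\<epsilon> > 0\<close> \<open>K \<ge> 0\<close> by (simp_all add: \<delta>_def field_simps)
  obtain N where N: "\<And>j. j \<ge> N \<Longrightarrow> \<bar>t j\<bar> < \<delta>"
    using LIMSEQ_D[OF t \<open>\<delta> > 0\<close>] by auto
  have "(\<lambda>n. \<Sum>j<N. \<bar>w n j * t j\<bar>) \<longlonglongrightarrow> (\<Sum>j<N. \<bar>0 * t j\<bar>)"
    by (intro tendsto_intros columns)
  then have "\<forall>\<^sub>F n in sequentially. (\<Sum>j<N. \<bar>w n j * t j\<bar>) < \<epsilon> / 2"
    using \<open>\<epsilon> > 0\<close> by (intro order_tendstoD(2)[where y = 0]) auto
  then obtain M where M: "\<And>n. n \<ge> M \<Longrightarrow> (\<Sum>j<N. \<bar>w n j * t j\<bar>) < \<epsilon> / 2"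
    by (auto simp: eventually_sequentially)
  show "\<exists>M. \<forall>n\<ge>M. norm ((\<Sum>j\<le>n. w n j * t j) - 0) < \<epsilon>"
  proof (intro exI[of _ "max M N"] allI impI)
    fix n assume n: "max M N \<le> n"
    have "\<bar>\<Sum>j\<le>n. w n j * t j\<bar> \<le> (\<Sum>j\<le>n. \<bar>w n j * t j\<bar>)"
      by (rule sum_abs)
    also have "\<dots> = (\<Sum>j\<in>{..<N} \<union> {N..n}. \<bar>w n j * t j\<bar>)"
      using n by (intro sum.cong) auto
    also have "\<dots> = (\<Sum>j<N. \<bar>w n j * t j\<bar>) + (\<Sum>j=N..n. \<bar>w n j * t j\<bar>)"
      by (rule sum.union_disjoint) auto
    also have "(\<Sum>j=N..n. \<bar>w n j * t j\<bar>) \<le> (\<Sum>j=N..n. \<bar>w n j\<bar> * \<delta>)"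
      unfolding abs_mult using N by (intro sum_mono mult_left_mono) (auto intro: less_imp_le)
    also have "\<dots> \<le> (\<Sum>j\<le>n. \<bar>w n j\<bar> * \<delta>)"
      using \<open>\<delta> > 0\<close> by (intro sum_mono2) auto
    also have "\<dots> \<le> K * \<delta>"
      using bounded[of n] \<open>\<delta> > 0\<close> by (simp flip: sum_distrib_right)
    finally show "norm ((\<Sum>j\<le>n. w n j * t j) - 0) < \<epsilon>"
      using M[of n] n \<open>K * \<delta> < \<epsilon> / 2\<close> by simp
  qed
qed

lemma silverman_toeplitz:
  fixes w :: "nat \<Rightarrow> nat \<Rightarrow> real"
  assumes "\<And>j. (\<lambda>n. w n j) \<longlonglongrightarrow> 0" "\<And>n. (\<Sum>j\<le>n. \<bar>w n j\<bar>) \<le> K"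
    and row_sums: "(\<lambda>n. \<Sum>j\<le>n. w n j) \<longlonglongrightarrow> s" and t: "t \<longlonglongrightarrow> c"
  shows "(\<lambda>n. \<Sum>j\<le>n. w n j * t j) \<longlonglongrightarrow> s * c"
proof -
  have "(\<lambda>n. \<Sum>j\<le>n. w n j * (t j - c)) \<longlonglongrightarrow> 0"
    using assms(1,2) t by (intro silverman_toeplitz_null LIM_zero)
  from tendsto_add[OF this tendsto_mult_right[OF row_sums, of c]]
  show ?thesis by (simp add: sum_distrib_right right_diff_distrib sum_subtractf)
qed

lemma pole_growth_geometric_power: "pole_growth p 1 (geometric ^ p)"
proof (cases p)
  case 0
  have "fps_nth 1 sums (\<Sum>n\<in>{0}. fps_nth (1 :: real fps) n)"
    by (rule sums_finite) auto
  moreover have "summable (\<lambda>n. \<bar>fps_nth (1 :: real fps) n\<bar>)"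
    by (rule summable_finite[of "{0}"]) auto
  ultimately show ?thesis using 0 by (simp add: pole_growth_0 sums_iff)
next
  case (Suc r)
  show ?thesis
    unfolding Suc pole_growth_Suc fps_nth_geometric_power
    using multichoose_Suc_pos[of r] by (simp add: less_imp_neq[symmetric])
qed

lemma pole_growth_coeff_bound:
  assumes "pole_growth (Suc p) c G"
  obtains K where "\<And>n. \<bar>fps_nth G n\<bar> \<le> K * multichoose (Suc p) n"
proof -
  have "Bseq (\<lambda>n. fps_nth G n / multichoose (Suc p) n)"
    using assms unfolding pole_growth_Suc by (intro convergent_imp_Bseq convergentI)
  then obtain K where "\<And>n. \<bar>fps_nth G n / multichoose (Suc p) n\<bar> \<le> K"
    by (auto simp: Bseq_def)
  then have "\<bar>fps_nth G n\<bar> \<le> K * multichoose (Suc p) n" for n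
    using multichoose_Suc_pos[of p n] by (metis abs_divide abs_of_pos pos_divide_le_eq)
  then show ?thesis by (rule that)
qed

lemma pole_growth_abs_convolution_bound:
  assumes "pole_growth p c G"
  obtains K where "\<And>n. (\<Sum>j\<le>n. multichoose (Suc q) j * \<bar>fps_nth G (n - j)\<bar>) \<le> K * multichoose (Suc (q + p)) n"
proof (cases p)
  case 0
  have G: "summable (\<lambda>n. \<bar>fps_nth G n\<bar>)"
    using assms 0 by (simp add: pole_growth_0)
  have "(\<Sum>j\<le>n. multichoose (Suc q) j * \<bar>fps_nth G (n - j)\<bar>)
      \<le> (\<Sum>j. \<bar>fps_nth G j\<bar>) * multichoose (Suc (q + p)) n" for n
  proof -
    have "(\<Sum>j\<le>n. multichoose (Suc q) j * \<bar>fps_nth G (n - j)\<bar>)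
        \<le> (\<Sum>j\<le>n. multichoose (Suc q) n * \<bar>fps_nth G (n - j)\<bar>)"
      by (intro sum_mono mult_right_mono monoD[OF mono_multichoose_Suc]) auto
    also have "\<dots> = multichoose (Suc q) n * (\<Sum>j\<le>n. \<bar>fps_nth G j\<bar>)"
      unfolding sum_distrib_left[symmetric]
      by (rule arg_cong[where f = "(*) _"], rule sum.reindex_bij_witness[of _ "\<lambda>j. n - j" "\<lambda>j. n - j"]) auto
    also have "\<dots> \<le> multichoose (Suc q) n * (\<Sum>j. \<bar>fps_nth G j\<bar>)"
      using multichoose_Suc_pos[of q n] by (intro mult_left_mono sum_le_suminf[OF G]) auto
    finally show ?thesis using 0 by (simp add: mult.commute)
  qed
  then show ?thesis by (rule that)
next
  case (Suc r)
  then obtain K where K: "\<And>n. \<bar>fps_nth G n\<bar> \<le> K * multichoose p n"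
    using assms pole_growth_coeff_bound by blast
  have "(\<Sum>j\<le>n. multichoose (Suc q) j * \<bar>fps_nth G (n - j)\<bar>) \<le> K * multichoose (Suc (q + p)) n" for n
  proof -
    have "(\<Sum>j\<le>n. multichoose (Suc q) j * \<bar>fps_nth G (n - j)\<bar>)
        \<le> (\<Sum>j\<le>n. multichoose (Suc q) j * (K * multichoose p (n - j)))"
      using multichoose_Suc_pos[of q] by (intro sum_mono mult_left_mono K) (auto intro: less_imp_le)
    also have "\<dots> = K * fps_nth (geometric ^ Suc q * geometric ^ p) n"
      unfolding fps_mult_nth fps_nth_geometric_power atLeast0AtMost sum_distrib_left
      by (simp add: mult.left_commute)
    also have "\<dots> = K * multichoose (Suc q + p) n"
      by (simp only: fps_nth_geometric_power flip: power_add)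
    finally show ?thesis by simp
  qed
  then show ?thesis by (rule that)
qed

lemma pole_growth_coeff_shift_tendsto_0:
  assumes G: "pole_growth p c G" and "p \<le> q"
  shows "(\<lambda>n. fps_nth G n / multichoose (Suc q) (n + j)) \<longlonglongrightarrow> 0"
proof (rule tendsto_0_le[where K = 1])
  show "(\<lambda>n. fps_nth G n / multichoose (Suc q) n) \<longlonglongrightarrow> 0"
    using pole_growth_higher_order[OF G, of "Suc q"] \<open>p \<le> q\<close> by (simp add: pole_growth_Suc)
  have "\<bar>fps_nth G n\<bar> / multichoose (Suc q) (n + j) \<le> \<bar>fps_nth G n\<bar> / multichoose (Suc q) n" for n
    using multichoose_Suc_pos[of q] by (intro divide_left_mono monoD[OF mono_multichoose_Suc] mult_pos_pos) auto
  then show "\<forall>\<^sub>F n in sequentially. norm (fps_nth G n / multichoose (Suc q) (n + j))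
      \<le> norm (fps_nth G n / multichoose (Suc q) n) * 1"
    using multichoose_Suc_pos[of q] by (simp add: abs_of_pos)
qed

text \<open>Coefficient \<open>n\<close> of \<open>F * G\<close>, divided by \<open>multichoose (Suc (q + p)) n\<close>, is a weighted mean of the ratios
  \<open>fps_nth F j / multichoose (Suc q) j\<close>; the row sums of the weights belong to the case \<open>F = 1 / (1 - z) ^ Suc q\<close>.\<close>
lemma pole_growth_mult_by_geometric_power:
  assumes F: "pole_growth (Suc q) b F" and G: "pole_growth p c G"
    and product: "pole_growth (Suc q + p) c (geometric ^ Suc q * G)"
  shows "pole_growth (Suc q + p) (b * c) (F * G)"
proof -
  let ?M = "multichoose (Suc (q + p))"
  define t where "t n = fps_nth F n / multichoose (Suc q) n" for n
  define w where "w n j = multichoose (Suc q) j * fps_nth G (n - j) / ?M n" for n j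
  have M_pos: "?M n > 0" for n by (rule multichoose_Suc_pos)
  have t: "t \<longlonglongrightarrow> b"
    using F unfolding t_def pole_growth_Suc .
  obtain K where K: "\<And>n. (\<Sum>j\<le>n. multichoose (Suc q) j * \<bar>fps_nth G (n - j)\<bar>) \<le> K * ?M n"
    using pole_growth_abs_convolution_bound[OF G] by blast
  have "(\<lambda>n. \<Sum>j\<le>n. w n j * t j) \<longlonglongrightarrow> c * b"
  proof (rule silverman_toeplitz[OF _ _ _ t])
    show "(\<lambda>n. w n j) \<longlonglongrightarrow> 0" for j
    proof (rule LIMSEQ_offset[where k = j])
      show "(\<lambda>n. w (n + j) j) \<longlonglongrightarrow> 0"
        using tendsto_mult_left[OF pole_growth_coeff_shift_tendsto_0[OF G, of "q + p" j], of "multichoose (Suc q) j"]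
        by (simp add: w_def)
    qed
    show "(\<Sum>j\<le>n. \<bar>w n j\<bar>) \<le> K" for n
    proof -
      have "(\<Sum>j\<le>n. \<bar>w n j\<bar>) = (\<Sum>j\<le>n. multichoose (Suc q) j * \<bar>fps_nth G (n - j)\<bar>) / ?M n"
        using M_pos multichoose_Suc_pos[of q] by (simp add: w_def abs_mult sum_divide_distrib less_imp_le)
      then show ?thesis using K M_pos[of n] by (simp add: pos_divide_le_eq)
    qed
    have "(\<Sum>j\<le>n. w n j) = fps_nth (geometric ^ Suc q * G) n / ?M n" for n
      unfolding fps_mult_nth fps_nth_geometric_power atLeast0AtMost w_def by (simp only: sum_divide_distrib)
    then show "(\<lambda>n. \<Sum>j\<le>n. w n j) \<longlonglongrightarrow> c"
      using product by (simp add: pole_growth_Suc del: power_Suc)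
  qed
  also have "(\<lambda>n. \<Sum>j\<le>n. w n j * t j) = (\<lambda>n. fps_nth (F * G) n / ?M n)"
    using multichoose_Suc_pos[of q]
    by (simp add: w_def t_def fps_mult_nth sum_divide_distrib atLeast0AtMost less_imp_neq[symmetric] mult.commute)
  finally show ?thesis by (simp add: pole_growth_Suc mult.commute)
qed

lemma pole_growth_geometric_power_mult:
  assumes "pole_growth p c G"
  shows "pole_growth (q + p) c (geometric ^ q * G)"
proof -
  have pole: "pole_growth (q + Suc r) c (geometric ^ q * G)" if G: "pole_growth (Suc r) c G" for q r G
    using pole_growth_mult_by_geometric_power[OF G pole_growth_geometric_power]
      pole_growth_geometric_power[of "Suc r + q"]
    by (simp add: power_add ac_simps)
  consider "q = 0" | r where "p = Suc r" | r where "p = 0" "q = Suc r"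
    by (meson not0_implies_Suc)
  then show ?thesis
  proof cases
    case 3
    let ?H = "geometric * G"
    have "fps_nth ?H = (\<lambda>n. \<Sum>i\<le>n. fps_nth G i)"
    proof
      fix n
      have "fps_nth ?H n = fps_nth (G * geometric) n" by (simp add: mult.commute)
      then show "fps_nth ?H n = (\<Sum>i\<le>n. fps_nth G i)" by (simp add: fps_mult_nth atLeast0AtMost)
    qed
    moreover have "(\<lambda>n. \<Sum>i\<le>n. fps_nth G i) \<longlonglongrightarrow> c"
      using assms 3 summable_LIMSEQ'[of "fps_nth G"] by (auto simp: pole_growth_0 summable_rabs_cancel)
    ultimately have "pole_growth (Suc 0) c ?H" by (simp add: pole_growth_Suc multichoose_Suc)
    from pole[OF this, of r] show ?thesis using 3 by (simp add: ac_simps)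
  qed (use assms pole in auto)
qed

proposition pole_growth_mult:
  assumes F: "pole_growth q b F" and G: "pole_growth p c G"
  shows "pole_growth (q + p) (b * c) (F * G)"
proof -
  have pole: "pole_growth (Suc q + p) (b * c) (F * G)"
    if "pole_growth (Suc q) b F" "pole_growth p c G" for q p b c F G
    using that by (intro pole_growth_mult_by_geometric_power pole_growth_geometric_power_mult)
  consider r where "q = Suc r" | r where "p = Suc r" | "q = 0" "p = 0"
    by (meson not0_implies_Suc)
  then show ?thesis
  proof cases
    case 1
    then show ?thesis using pole F G by simp
  next
    case 2
    then show ?thesis using pole[of r c G q b F] F G by (simp add: ac_simps)
  next
    case 3
    have sF: "summable (\<lambda>n. \<bar>fps_nth F n\<bar>)" "suminf (fps_nth F) = b"
      and sG: "summable (\<lambda>n. \<bar>fps_nth G n\<bar>)" "suminf (fps_nth G) = c"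
      using F G 3 by (auto simp: pole_growth_0)
    have nth: "fps_nth (F * G) = (\<lambda>n. \<Sum>i\<le>n. fps_nth F i * fps_nth G (n - i))"
      by (simp add: fun_eq_iff fps_mult_nth atLeast0AtMost)
    have "summable (\<lambda>n. \<Sum>i\<le>n. \<bar>fps_nth F i\<bar> * \<bar>fps_nth G (n - i)\<bar>)"
      using sF sG by (intro summable_Cauchy_product) auto
    then have "summable (\<lambda>n. \<bar>fps_nth (F * G) n\<bar>)"
      unfolding nth by (rule summable_comparison_test'[where N = 0])
        (auto simp flip: abs_mult intro: sum_abs)
    moreover have "suminf (fps_nth (F * G)) = b * c"
      unfolding nth using Cauchy_product[of "fps_nth F" "fps_nth G"] sF sG by simp
    ultimately show ?thesis using 3 by (simp add: pole_growth_0)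
  qed
qed

lemma pole_growth_quotient_tendsto:
  assumes F: "pole_growth (Suc h) c F" and G: "pole_growth h d G" and "h \<ge> 1" "d \<noteq> 0"
  shows "(\<lambda>n. fps_nth F n / real (Suc n) / fps_nth G n) \<longlonglongrightarrow> c / d * (1 / real h)"
proof -
  obtain r where h: "h = Suc r" using \<open>h \<ge> 1\<close> by (cases h) auto
  let ?ratio = "\<lambda>n. multichoose (Suc h) n / multichoose h n / real (Suc n)"
  have "(\<lambda>n. 1 / real h * (1 + real r / real (Suc n))) \<longlonglongrightarrow> 1 / real h * (1 + 0)"
    by (intro tendsto_intros LIMSEQ_Suc[OF lim_const_over_n])
  also have "(\<lambda>n. 1 / real h * (1 + real r / real (Suc n))) = ?ratio"
    unfolding h multichoose_ratio by (simp add: field_simps)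
  finally have "?ratio \<longlonglongrightarrow> 1 / real h" by simp
  then have "(\<lambda>n. (fps_nth F n / multichoose (Suc h) n) / (fps_nth G n / multichoose h n) * ?ratio n)
      \<longlonglongrightarrow> c / d * (1 / real h)"
    using F G \<open>d \<noteq> 0\<close> unfolding h pole_growth_Suc by (intro tendsto_mult[OF tendsto_divide])
  moreover have "(fps_nth F n / multichoose (Suc h) n) / (fps_nth G n / multichoose h n) * ?ratio n
      = fps_nth F n / real (Suc n) / fps_nth G n" for n
    using multichoose_Suc_pos[of h n] multichoose_Suc_pos[of r n] by (simp add: h)
  ultimately show ?thesis by (simp only:)
qed

section \<open>Powers and resolvents of matrices indexed by finite sets\<close>

primrec matpow :: "'a set \<Rightarrow> ('a \<Rightarrow> 'a \<Rightarrow> 'b::comm_semiring_1) \<Rightarrow> nat \<Rightarrow> 'a \<Rightarrow> 'a \<Rightarrow> 'b" where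
  "matpow S A 0 a b = of_bool (a = b)"
| "matpow S A (Suc n) a b = (\<Sum>c\<in>S. A a c * matpow S A n c b)"

lemma matpow_add:
  assumes "finite S" "a \<in> S"
  shows "matpow S A (m + n) a b = (\<Sum>c\<in>S. matpow S A m a c * matpow S A n c b)"
  using assms(2)
proof (induction m arbitrary: a)
  case 0
  then show ?case using assms(1) by (simp add: of_bool_def if_distrib if_distribR cong: if_cong)
next
  case (Suc m)
  have "matpow S A (Suc m + n) a b = (\<Sum>e\<in>S. \<Sum>c\<in>S. A a e * (matpow S A m e c * matpow S A n c b))"
    using Suc by (simp add: sum_distrib_left)
  also have "\<dots> = (\<Sum>c\<in>S. \<Sum>e\<in>S. A a e * (matpow S A m e c * matpow S A n c b))"
    by (rule sum.swap)
  finally show ?case by (simp add: sum_distrib_right mult.assoc)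
qed

lemma matpow_Suc_right:
  assumes "finite S" "a \<in> S" "b \<in> S"
  shows "matpow S A (Suc n) a b = (\<Sum>c\<in>S. matpow S A n a c * A c b)"
proof -
  have "matpow S A 1 c b = A c b" for c
    using assms(1,3) by (simp add: of_bool_def if_distrib if_distribR cong: if_cong)
  then show ?thesis using matpow_add[OF assms(1,2), of A n 1 b] by simp
qed

lemma matpow_transpose:
  assumes "finite S" "a \<in> S" "b \<in> S"
  shows "matpow S (\<lambda>a b. A b a) n a b = matpow S A n b a"
  using assms(2,3)
proof (induction n arbitrary: a)
  case (Suc n)
  have "matpow S (\<lambda>a b. A b a) (Suc n) a b = (\<Sum>c\<in>S. matpow S A n b c * A c a)"
    using Suc by (simp add: mult.commute)
  then show ?case by (simp only: matpow_Suc_right[OF assms(1) Suc.prems(2,1)])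
qed auto

lemma matpow_nonneg:
  fixes A :: "'a \<Rightarrow> 'a \<Rightarrow> 'b::linordered_idom"
  assumes "\<And>a b. a \<in> S \<Longrightarrow> b \<in> S \<Longrightarrow> A a b \<ge> 0" "a \<in> S" "b \<in> S"
  shows "matpow S A n a b \<ge> 0"
  using assms(2) by (induction n arbitrary: a) (auto intro!: sum_nonneg mult_nonneg_nonneg assms)

lemma matpow_fixed_vector:
  assumes "finite S" "\<And>a. a \<in> S \<Longrightarrow> (\<Sum>b\<in>S. A a b * f b) = f a" "a \<in> S"
  shows "(\<Sum>b\<in>S. matpow S A n a b * f b) = f a"
  using assms(3)
proof (induction n arbitrary: a)
  case 0
  then show ?case using assms(1) by (simp add: of_bool_def if_distrib if_distribR cong: if_cong)
next
  case (Suc n)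
  have "(\<Sum>b\<in>S. matpow S A (Suc n) a b * f b) = (\<Sum>b\<in>S. \<Sum>c\<in>S. A a c * (matpow S A n c b * f b))"
    by (simp add: sum_distrib_right mult.assoc)
  also have "\<dots> = (\<Sum>c\<in>S. A a c * (\<Sum>b\<in>S. matpow S A n c b * f b))"
    by (subst sum.swap) (simp add: sum_distrib_left)
  finally show ?case using Suc assms(2) by simp
qed

lemma matpow_divide:
  fixes A :: "'a \<Rightarrow> 'a \<Rightarrow> 'b::field"
  shows "matpow S (\<lambda>a b. A a b / r) n a b = matpow S A n a b / r ^ n"
  by (induction n arbitrary: a) (simp_all add: sum_divide_distrib)

lemma matpow_reindex:
  assumes f: "bij_betw f S T" and A: "\<And>a b. a \<in> S \<Longrightarrow> b \<in> S \<Longrightarrow> A (f a) (f b) = A' a b"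
    and "a \<in> S" "b \<in> S"
  shows "matpow T A n (f a) (f b) = matpow S A' n a b"
  using assms(3)
proof (induction n arbitrary: a)
  case 0
  then show ?case using f \<open>b \<in> S\<close> by (auto simp: bij_betw_def inj_on_eq_iff)
next
  case (Suc n)
  then show ?case using A by (simp flip: sum.reindex_bij_betw[OF f])
qed

lemma matpow_diagonal_similarity:
  fixes v :: "'a \<Rightarrow> 'b::field"
  assumes "\<And>c. c \<in> S \<Longrightarrow> v c \<noteq> 0" "a \<in> S" "b \<in> S"
  shows "matpow S (\<lambda>a b. A a b * v b / v a) n a b = matpow S A n a b * v b / v a"
  using assms(2)
proof (induction n arbitrary: a)
  case (Suc n)
  have "matpow S (\<lambda>a b. A a b * v b / v a) (Suc n) a b
      = (\<Sum>c\<in>S. A a c * v c / v a * (matpow S A n c b * v b / v c))"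
    using Suc by simp
  also have "\<dots> = (\<Sum>c\<in>S. A a c * matpow S A n c b * v b / v a)"
    using assms(1) by (intro sum.cong) auto
  finally show ?case by (simp add: sum_divide_distrib sum_distrib_right)
qed (use assms in auto)

definition resolvent :: "'a set \<Rightarrow> ('a \<Rightarrow> 'a \<Rightarrow> 'b::comm_semiring_1) \<Rightarrow> 'a \<Rightarrow> 'a \<Rightarrow> 'b fps" where
  "resolvent S A a b = Abs_fps (\<lambda>n. matpow S A n a b)"

lemma fps_nth_resolvent [simp]: "fps_nth (resolvent S A a b) n = matpow S A n a b"
  by (simp add: resolvent_def)

lemma resolvent_unfold:
  "resolvent S A a b = of_bool (a = b) + fps_X * (\<Sum>c\<in>S. fps_const (A a c) * resolvent S A c b)"
proof (rule fps_ext)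
  fix n
  show "fps_nth (resolvent S A a b) n
      = fps_nth (of_bool (a = b) + fps_X * (\<Sum>c\<in>S. fps_const (A a c) * resolvent S A c b)) n"
    by (cases n) (auto simp: fps_sum_nth)
qed

lemma fps_linear_system_eq_0:
  fixes x :: "'a \<Rightarrow> 'b::comm_ring_1 fps"
  assumes "\<And>a. a \<in> S \<Longrightarrow> x a = fps_X * (\<Sum>c\<in>S. fps_const (A a c) * x c)" "a \<in> S"
  shows "x a = 0"
proof -
  have "fps_nth (x a) n = 0" if "a \<in> S" for n
    using that
  proof (induction n arbitrary: a)
    case 0
    then show ?case by (subst assms(1)) auto
  next
    case (Suc n)
    have "fps_nth (x a) (Suc n) = (\<Sum>c\<in>S. A a c * fps_nth (x c) n)"
      by (subst assms(1)[OF Suc.prems]) (simp add: fps_sum_nth)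
    then show ?case using Suc.IH by simp
  qed
  with assms(2) show ?thesis by (simp add: fps_eq_iff)
qed

lemma fps_linear_system_solution:
  fixes x y :: "'a \<Rightarrow> 'b::comm_ring_1 fps"
  assumes "finite S" and system: "\<And>a. a \<in> S \<Longrightarrow> x a = y a + fps_X * (\<Sum>c\<in>S. fps_const (A a c) * x c)"
    and "a \<in> S"
  shows "x a = (\<Sum>b\<in>S. resolvent S A a b * y b)"
proof -
  define z where "z a = (\<Sum>b\<in>S. resolvent S A a b * y b)" for a
  have z: "z a = y a + fps_X * (\<Sum>c\<in>S. fps_const (A a c) * z c)" if "a \<in> S" for a
  proof -
    have "z a = (\<Sum>b\<in>S. of_bool (a = b) * y b)
        + fps_X * (\<Sum>b\<in>S. \<Sum>c\<in>S. fps_const (A a c) * (resolvent S A c b * y b))"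
      unfolding z_def by (subst resolvent_unfold)
        (simp add: distrib_right sum.distrib sum_distrib_left sum_distrib_right mult.assoc)
    also have "(\<Sum>b\<in>S. of_bool (a = b) * y b) = y a"
      using \<open>finite S\<close> that by (simp add: of_bool_def if_distrib if_distribR cong: if_cong)
    also have "(\<Sum>b\<in>S. \<Sum>c\<in>S. fps_const (A a c) * (resolvent S A c b * y b))
        = (\<Sum>c\<in>S. fps_const (A a c) * z c)"
      unfolding z_def sum_distrib_left by (rule sum.swap)
    finally show ?thesis .
  qed
  have "x a - z a = 0"
  proof (rule fps_linear_system_eq_0[where S = S and A = A and x = "\<lambda>a. x a - z a"])
    fix a assume "a \<in> S"
    then show "x a - z a = fps_X * (\<Sum>c\<in>S. fps_const (A a c) * (x c - z c))"
      by (subst system, assumption, subst z, assumption)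
        (simp add: right_diff_distrib sum_subtractf)
  qed fact
  then show ?thesis by (simp add: z_def)
qed

definition resolvent_form :: "'a set \<Rightarrow> ('a \<Rightarrow> 'a \<Rightarrow> real) \<Rightarrow> ('a \<Rightarrow> real) \<Rightarrow> ('a \<Rightarrow> real) \<Rightarrow> real fps" where
  "resolvent_form S A f g = (\<Sum>a\<in>S. \<Sum>b\<in>S. fps_const (f a * g b) * resolvent S A a b)"

lemma fps_nth_resolvent_form:
  "fps_nth (resolvent_form S A f g) n = (\<Sum>a\<in>S. \<Sum>b\<in>S. f a * g b * matpow S A n a b)"
  by (simp add: resolvent_form_def fps_sum_nth)

lemma fps_nth_resolvent_form_indicator_left:
  assumes "finite S" "s \<in> S"
  shows "fps_nth (resolvent_form S A (\<lambda>a. of_bool (a = s)) g) n = (\<Sum>b\<in>S. g b * matpow S A n s b)"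
proof -
  have "fps_nth (resolvent_form S A (\<lambda>a. of_bool (a = s)) g) n
      = (\<Sum>b\<in>S. \<Sum>a\<in>S. of_bool (a = s) * g b * matpow S A n a b)"
    unfolding fps_nth_resolvent_form by (rule sum.swap)
  then show ?thesis
    using assms by (simp add: of_bool_def if_distrib if_distribR cong: if_cong)
qed

lemma fps_nth_resolvent_form_indicator_right:
  assumes "finite S" "s \<in> S"
  shows "fps_nth (resolvent_form S A f (\<lambda>b. of_bool (b = s))) n = (\<Sum>a\<in>S. f a * matpow S A n a s)"
  using assms by (simp add: fps_nth_resolvent_form of_bool_def if_distrib if_distribR cong: if_cong)

lemma fps_nth_resolvent_form_divide:
  "fps_nth (resolvent_form S (\<lambda>a b. A a b / r) f g) n = fps_nth (resolvent_form S A f g) n / r ^ n"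
  by (simp add: fps_nth_resolvent_form matpow_divide sum_divide_distrib)

section \<open>Perron limits\<close>

definition row_stochastic :: "'a set \<Rightarrow> ('a \<Rightarrow> 'a \<Rightarrow> real) \<Rightarrow> bool" where
  "row_stochastic S P \<longleftrightarrow> (\<forall>a\<in>S. (\<forall>b\<in>S. P a b \<ge> 0) \<and> (\<Sum>b\<in>S. P a b) = 1)"

lemma row_stochastic_matpow:
  assumes "finite S" "row_stochastic S P"
  shows "row_stochastic S (matpow S P n)"
  using assms matpow_fixed_vector[of S P "\<lambda>_. 1"] by (auto simp: row_stochastic_def intro: matpow_nonneg)

lemma row_stochastic_mean_le:
  assumes "row_stochastic S P" "a \<in> S" "\<And>b. b \<in> S \<Longrightarrow> f b \<le> hi"
  shows "(\<Sum>b\<in>S. P a b * f b) \<le> hi"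
proof -
  have "(\<Sum>b\<in>S. P a b * f b) \<le> (\<Sum>b\<in>S. P a b * hi)"
    using assms by (intro sum_mono mult_left_mono) (auto simp: row_stochastic_def)
  also have "\<dots> = hi" using assms(1,2) by (simp add: row_stochastic_def flip: sum_distrib_right)
  finally show ?thesis .
qed

lemma row_stochastic_mean_ge:
  assumes "row_stochastic S P" "a \<in> S" "\<And>b. b \<in> S \<Longrightarrow> lo \<le> f b"
  shows "lo \<le> (\<Sum>b\<in>S. P a b * f b)"
  using row_stochastic_mean_le[OF assms(1,2), of "\<lambda>b. - f b" "- lo"] assms(3) by (simp add: sum_negf)

lemma row_stochastic_mean_le_doeblin:
  assumes P: "finite S" "row_stochastic S P" "a \<in> S" and c: "c \<in> S" "P a c \<ge> \<delta>"
    and f: "\<And>b. b \<in> S \<Longrightarrow> f b \<le> hi"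
  shows "(\<Sum>b\<in>S. P a b * f b) \<le> hi - \<delta> * (hi - f c)"
proof -
  have "(\<Sum>b\<in>S. P a b * f b) = P a c * f c + (\<Sum>b\<in>S - {c}. P a b * f b)"
    using P(1) c by (simp add: sum.remove)
  also have "(\<Sum>b\<in>S - {c}. P a b * f b) \<le> (\<Sum>b\<in>S - {c}. P a b * hi)"
    using P f by (intro sum_mono mult_left_mono) (auto simp: row_stochastic_def)
  also have "\<dots> = (1 - P a c) * hi"
    using P c sum.remove[of S c "P a"] by (simp add: row_stochastic_def flip: sum_distrib_right)
  also have "P a c * f c + (1 - P a c) * hi = hi - P a c * (hi - f c)"
    by (simp add: algebra_simps)
  also have "\<dots> \<le> hi - \<delta> * (hi - f c)"
    using c(2) f[OF c(1)] by (intro diff_left_mono mult_right_mono) auto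
  finally show ?thesis by simp
qed

lemma nested_intervals_common_limit:
  fixes lo hi :: "nat \<Rightarrow> real"
  assumes "incseq lo" "decseq hi" and le: "\<And>n. lo n \<le> hi n"
    and contraction: "\<And>n. hi (N + n) - lo (N + n) \<le> q * (hi n - lo n)" and "q < 1"
  obtains L where "lo \<longlonglongrightarrow> L" "hi \<longlonglongrightarrow> L"
proof -
  have "lo n \<le> hi 0" "lo 0 \<le> hi n" for n
    using le[of n] decseqD[OF \<open>decseq hi\<close>, of 0 n] incseqD[OF \<open>incseq lo\<close>, of 0 n] by simp_all
  then obtain L H where L: "lo \<longlonglongrightarrow> L" and H: "hi \<longlonglongrightarrow> H"
    using incseq_convergent[OF \<open>incseq lo\<close>] decseq_convergent[OF \<open>decseq hi\<close>] by metis
  have "(\<lambda>n. hi (N + n) - lo (N + n)) \<longlonglongrightarrow> H - L"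
    using LIMSEQ_ignore_initial_segment[OF H, of N] LIMSEQ_ignore_initial_segment[OF L, of N]
    by (intro tendsto_diff) (simp_all add: add.commute)
  moreover have "(\<lambda>n. q * (hi n - lo n)) \<longlonglongrightarrow> q * (H - L)"
    by (intro tendsto_intros H L)
  ultimately have "H - L \<le> q * (H - L)"
    by (rule LIMSEQ_le) (use contraction in auto)
  then have "(1 - q) * (H - L) \<le> 0" by (simp add: algebra_simps)
  then have "H \<le> L" using \<open>q < 1\<close> by (simp add: mult_le_0_iff)
  moreover have "L \<le> H" by (rule LIMSEQ_le[OF L H]) (use le in auto)
  ultimately show ?thesis using L H that by simp
qed

text \<open>Doeblin's argument: a positive power of \<open>P\<close> contracts the oscillation of every column.\<close>
lemma row_stochastic_matpow_tendsto:
  assumes S: "finite S" and P: "row_stochastic S P"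
    and N_pos: "\<And>a b. a \<in> S \<Longrightarrow> b \<in> S \<Longrightarrow> matpow S P N a b > 0"
    and b: "b \<in> S"
  obtains L where "L \<ge> 0" "\<And>a. a \<in> S \<Longrightarrow> (\<lambda>n. matpow S P n a b) \<longlonglongrightarrow> L"
proof -
  define f where "f n a = matpow S P n a b" for n a
  define lo where "lo n = Min (f n ` S)" for n
  define hi where "hi n = Max (f n ` S)" for n
  define \<delta> where "\<delta> = Min ((\<lambda>(a, c). matpow S P N a c) ` (S \<times> S))"
  have f_add: "f (m + n) a = (\<Sum>c\<in>S. matpow S P m a c * f n c)" if "a \<in> S" for m n a
    unfolding f_def by (rule matpow_add[OF S that])
  have \<delta>_le: "\<delta> \<le> matpow S P N a c" if "a \<in> S" "c \<in> S" for a c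
    unfolding \<delta>_def using S that by (intro Min_le) auto
  have "\<delta> > 0"
    unfolding \<delta>_def using S b N_pos by (subst Min_gr_iff) auto
  have lo_le: "lo n \<le> f n a" and le_hi: "f n a \<le> hi n" if "a \<in> S" for n a
    using S that by (auto simp: lo_def hi_def)
  have lo_attained: "\<exists>a\<in>S. f n a = lo n" and hi_attained: "\<exists>a\<in>S. f n a = hi n" for n
    using Min_in[of "f n ` S"] Max_in[of "f n ` S"] S b unfolding lo_def hi_def by fastforce+
  have lo_mono: "lo n \<le> lo (m + n)" and hi_antimono: "hi (m + n) \<le> hi n" for m n
    using lo_attained[of "m + n"] hi_attained[of "m + n"] lo_le le_hi f_add
      row_stochastic_mean_ge[OF row_stochastic_matpow[OF S P]]
      row_stochastic_mean_le[OF row_stochastic_matpow[OF S P]] by metis+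
  have contraction: "hi (N + n) - lo (N + n) \<le> (1 - \<delta>) * (hi n - lo n)" for n
  proof -
    obtain c where c: "c \<in> S" "f n c = lo n" using lo_attained by blast
    obtain a where a: "a \<in> S" "f (N + n) a = hi (N + n)" using hi_attained by blast
    have "hi (N + n) \<le> hi n - \<delta> * (hi n - lo n)"
      using row_stochastic_mean_le_doeblin[OF S row_stochastic_matpow[OF S P] a(1) c(1) \<delta>_le[OF a(1) c(1)], of "f n"]
        le_hi a c f_add by metis
    with lo_mono[of n N] show ?thesis by (simp add: algebra_simps)
  qed
  obtain L where L: "lo \<longlonglongrightarrow> L" "hi \<longlonglongrightarrow> L"
  proof (rule nested_intervals_common_limit[of lo hi N "1 - \<delta>"])
    show "incseq lo" "decseq hi"
      using lo_mono[of _ 1] hi_antimono[of 1] by (auto intro: incseq_SucI decseq_SucI)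
    show "lo n \<le> hi n" for n using lo_le[OF b, of n] le_hi[OF b, of n] by simp
  qed (use contraction \<open>\<delta> > 0\<close> in auto)
  have lim: "(\<lambda>n. matpow S P n a b) \<longlonglongrightarrow> L" if "a \<in> S" for a
    unfolding f_def[symmetric]
    by (rule tendsto_sandwich[OF _ _ L]) (use lo_le le_hi that in auto)
  moreover have "L \<ge> 0"
    using P b by (intro LIMSEQ_le_const[OF lim[OF b]]) (auto simp: row_stochastic_def intro: matpow_nonneg)
  ultimately show ?thesis using that by blast
qed

lemma matpow_perron_limit:
  assumes S: "finite S" and A_nonneg: "\<And>a b. a \<in> S \<Longrightarrow> b \<in> S \<Longrightarrow> A a b \<ge> (0 :: real)"
    and v_pos: "\<And>a. a \<in> S \<Longrightarrow> v a > 0" and v_fixed: "\<And>a. a \<in> S \<Longrightarrow> (\<Sum>b\<in>S. A a b * v b) = v a"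
    and N_pos: "\<And>a b. a \<in> S \<Longrightarrow> b \<in> S \<Longrightarrow> matpow S A N a b > 0"
  obtains u where "\<And>b. b \<in> S \<Longrightarrow> u b \<ge> 0"
    and "\<And>a b. a \<in> S \<Longrightarrow> b \<in> S \<Longrightarrow> (\<lambda>n. matpow S A n a b) \<longlonglongrightarrow> v a * u b"
proof -
  define P where "P a b = A a b * v b / v a" for a b
  have P_pow: "matpow S P n a b = matpow S A n a b * v b / v a" if "a \<in> S" "b \<in> S" for n a b
    unfolding P_def using v_pos that by (intro matpow_diagonal_similarity) force+
  have "row_stochastic S P"
    using A_nonneg v_pos v_fixed
    by (auto simp: row_stochastic_def P_def less_imp_le less_imp_neq[symmetric] simp flip: sum_divide_distrib)
  moreover have "matpow S P N a b > 0" if "a \<in> S" "b \<in> S" for a b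
    using N_pos v_pos that by (simp add: P_pow)
  ultimately have "\<forall>b\<in>S. \<exists>L\<ge>0. \<forall>a\<in>S. (\<lambda>n. matpow S P n a b) \<longlonglongrightarrow> L"
    using row_stochastic_matpow_tendsto[OF S] by metis
  then obtain L where L: "\<And>b. b \<in> S \<Longrightarrow> L b \<ge> 0"
    and lim: "\<And>a b. a \<in> S \<Longrightarrow> b \<in> S \<Longrightarrow> (\<lambda>n. matpow S P n a b) \<longlonglongrightarrow> L b"
    by metis
  show ?thesis
  proof (rule that[of "\<lambda>b. L b / v b"])
    show "L b / v b \<ge> 0" if "b \<in> S" for b using L v_pos that by (simp add: less_imp_le)
    show "(\<lambda>n. matpow S A n a b) \<longlonglongrightarrow> v a * (L b / v b)" if "a \<in> S" "b \<in> S" for a b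
      using tendsto_mult_left[OF lim[OF that], of "v a / v b"] v_pos[OF that(1)] v_pos[OF that(2)]
      by (simp add: P_pow that)
  qed
qed

lemma matpow_rank_one_limit_right_fixed:
  fixes A :: "'a \<Rightarrow> 'a \<Rightarrow> real"
  assumes "finite S"
    and lim: "\<And>a b. a \<in> S \<Longrightarrow> b \<in> S \<Longrightarrow> (\<lambda>n. matpow S A n a b) \<longlonglongrightarrow> v a * u b"
    and fixed: "\<And>a. a \<in> S \<Longrightarrow> (\<Sum>b\<in>S. A a b * g b) = g a" and "a \<in> S"
  shows "g a = v a * (\<Sum>b\<in>S. u b * g b)"
proof -
  have "(\<lambda>n. \<Sum>b\<in>S. matpow S A n a b * g b) \<longlonglongrightarrow> (\<Sum>b\<in>S. v a * u b * g b)"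
    by (intro tendsto_intros lim \<open>a \<in> S\<close>)
  moreover have "(\<Sum>b\<in>S. matpow S A n a b * g b) = g a" for n
    by (rule matpow_fixed_vector) fact+
  ultimately show ?thesis
    using LIMSEQ_unique[OF tendsto_const] by (fastforce simp: sum_distrib_left mult.assoc)
qed

lemma matpow_rank_one_limit_left_fixed:
  fixes A :: "'a \<Rightarrow> 'a \<Rightarrow> real"
  assumes "finite S"
    and lim: "\<And>a b. a \<in> S \<Longrightarrow> b \<in> S \<Longrightarrow> (\<lambda>n. matpow S A n a b) \<longlonglongrightarrow> v a * u b"
    and fixed: "\<And>b. b \<in> S \<Longrightarrow> (\<Sum>a\<in>S. w a * A a b) = w b" and "b \<in> S"
  shows "w b = (\<Sum>a\<in>S. w a * v a) * u b"
proof -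
  have "w b = u b * (\<Sum>a\<in>S. v a * w a)"
  proof (rule matpow_rank_one_limit_right_fixed[where A = "\<lambda>a b. A b a" and S = S])
    show "(\<lambda>n. matpow S (\<lambda>a b. A b a) n a b) \<longlonglongrightarrow> u a * v b" if "a \<in> S" "b \<in> S" for a b
      using lim[OF that(2,1)] by (simp only: matpow_transpose[OF \<open>finite S\<close> that] mult.commute)
    show "(\<Sum>b\<in>S. A b a * w b) = w a" if "a \<in> S" for a
      using fixed[OF that] by (simp add: mult.commute)
  qed fact+
  then show ?thesis by (simp add: mult.commute)
qed

lemma matpow_rank_one_limit_is_left_fixed:
  fixes A :: "'a \<Rightarrow> 'a \<Rightarrow> real"
  assumes "finite S" and lim: "\<And>a b. a \<in> S \<Longrightarrow> b \<in> S \<Longrightarrow> (\<lambda>n. matpow S A n a b) \<longlonglongrightarrow> v a * u b"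
    and "a \<in> S" "v a \<noteq> 0" "b \<in> S"
  shows "(\<Sum>c\<in>S. u c * A c b) = u b"
proof -
  have "(\<lambda>n. matpow S A (Suc n) a b) \<longlonglongrightarrow> (\<Sum>c\<in>S. v a * u c * A c b)"
    unfolding matpow_Suc_right[OF \<open>finite S\<close> \<open>a \<in> S\<close> \<open>b \<in> S\<close>] by (intro tendsto_intros lim \<open>a \<in> S\<close>)
  moreover have "(\<lambda>n. matpow S A (Suc n) a b) \<longlonglongrightarrow> v a * u b"
    by (intro LIMSEQ_Suc lim \<open>a \<in> S\<close> \<open>b \<in> S\<close>)
  ultimately have "(\<Sum>c\<in>S. v a * u c * A c b) = v a * u b"
    by (rule LIMSEQ_unique)
  then show ?thesis using \<open>v a \<noteq> 0\<close> by (simp add: mult.assoc flip: sum_distrib_left)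
qed

section \<open>Block triangular matrices\<close>

lemma strictly_decreasing_imp_distinct: "sorted_wrt (>) xs \<Longrightarrow> distinct xs" for xs :: "nat list"
  by (induction xs) auto

locale block_triangular =
  fixes A :: "'a \<Rightarrow> 'a \<Rightarrow> real" and B :: "nat \<Rightarrow> 'a set" and k :: nat
  assumes finite_block: "\<And>i. i \<in> {1..k} \<Longrightarrow> finite (B i)"
    and disjoint_blocks: "\<And>i j. i \<in> {1..k} \<Longrightarrow> j \<in> {1..k} \<Longrightarrow> i \<noteq> j \<Longrightarrow> B i \<inter> B j = {}"
    and triangular: "\<And>i j a b. i \<in> {1..k} \<Longrightarrow> j \<in> {1..k} \<Longrightarrow> i < j \<Longrightarrow> a \<in> B i \<Longrightarrow> b \<in> B j \<Longrightarrow> A a b = 0"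
begin

definition states :: "'a set" where
  "states = (\<Union>i\<in>{1..k}. B i)"

definition linked :: "nat \<Rightarrow> nat \<Rightarrow> bool" where
  "linked i j \<longleftrightarrow> (\<exists>a\<in>B i. \<exists>b\<in>B j. A a b \<noteq> 0)"

definition paths :: "nat list set" where
  "paths = {\<theta>. \<theta> \<noteq> [] \<and> sorted_wrt (>) \<theta> \<and> set \<theta> \<subseteq> {1..k} \<and> successively linked \<theta>}"

definition paths_between :: "nat \<Rightarrow> nat \<Rightarrow> nat list set" where
  "paths_between i j = {\<theta> \<in> paths. hd \<theta> = i \<and> last \<theta> = j}"

fun path_resolvent :: "nat list \<Rightarrow> 'a \<Rightarrow> 'a \<Rightarrow> real fps" where
  "path_resolvent [] a b = 0"
| "path_resolvent [i] a b = resolvent (B i) A a b"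
| "path_resolvent (i # j # \<theta>) a b = fps_X * (\<Sum>c\<in>B i. \<Sum>e\<in>B j.
     fps_const (A c e) * (resolvent (B i) A a c * path_resolvent (j # \<theta>) e b))"

lemma finite_paths: "finite paths"
proof (rule finite_subset)
  show "paths \<subseteq> {\<theta>. set \<theta> \<subseteq> {1..k} \<and> distinct \<theta>}"
    using strictly_decreasing_imp_distinct by (auto simp: paths_def)
  show "finite {\<theta>. set \<theta> \<subseteq> {1..k} \<and> distinct \<theta>}"
    by (rule finite_subset_distinct) simp
qed

lemma finite_paths_between: "finite (paths_between i j)"
  using finite_paths by (simp add: paths_between_def)

lemma paths_ends: "\<theta> \<in> paths \<Longrightarrow> hd \<theta> \<in> {1..k} \<and> last \<theta> \<in> {1..k}"
  using hd_in_set last_in_set unfolding paths_def by blast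

lemma paths_between_unfold:
  assumes i: "i \<in> {1..k}"
  shows "paths_between i j = (if i = j then {[i]} else {}) \<union>
    (\<Union>l\<in>{l \<in> {1..<i}. linked i l}. (#) i ` paths_between l j)"
proof (intro Set.set_eqI iffI)
  fix \<theta> assume \<theta>: "\<theta> \<in> paths_between i j"
  then obtain \<theta>' where "\<theta> = i # \<theta>'" by (cases \<theta>) (auto simp: paths_between_def paths_def)
  with \<theta> show "\<theta> \<in> (if i = j then {[i]} else {}) \<union>
      (\<Union>l\<in>{l \<in> {1..<i}. linked i l}. (#) i ` paths_between l j)"
    by (cases \<theta>') (auto simp: paths_between_def paths_def)
next
  fix \<theta> assume "\<theta> \<in> (if i = j then {[i]} else {}) \<union>
      (\<Union>l\<in>{l \<in> {1..<i}. linked i l}. (#) i ` paths_between l j)"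
  then consider "i = j" "\<theta> = [i]"
    | \<theta>' where "\<theta>' \<in> paths" "last \<theta>' = j" "hd \<theta>' < i" "linked i (hd \<theta>')" "\<theta> = i # \<theta>'"
    by (auto simp: paths_between_def split: if_splits)
  then show "\<theta> \<in> paths_between i j"
  proof cases
    case 2
    obtain l \<theta>'' where "\<theta>' = l # \<theta>''" using 2(1) by (cases \<theta>') (auto simp: paths_def)
    with 2 i show ?thesis by (auto simp: paths_between_def paths_def)
  qed (use i in \<open>simp add: paths_between_def paths_def\<close>)
qed

lemma sum_paths_between:
  assumes i: "i \<in> {1..k}"
  shows "(\<Sum>\<theta>\<in>paths_between i j. g \<theta>) = (if i = j then g [i] else 0) +
    (\<Sum>l\<in>{l \<in> {1..<i}. linked i l}. \<Sum>\<theta>\<in>paths_between l j. g (i # \<theta>))" (is "_ = ?one + _")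
proof -
  let ?long = "\<Union>l\<in>{l \<in> {1..<i}. linked i l}. (#) i ` paths_between l j"
  have "(\<Sum>\<theta>\<in>paths_between i j. g \<theta>) = (\<Sum>\<theta>\<in>(if i = j then {[i]} else {}). g \<theta>) + (\<Sum>\<theta>\<in>?long. g \<theta>)"
    unfolding paths_between_unfold[OF i]
    by (rule sum.union_disjoint) (auto simp: finite_paths_between, auto simp: paths_between_def paths_def)
  also have "(\<Sum>\<theta>\<in>(if i = j then {[i]} else {}). g \<theta>) = ?one" by simp
  also have "(\<Sum>\<theta>\<in>?long. g \<theta>) = (\<Sum>l\<in>{l \<in> {1..<i}. linked i l}. \<Sum>\<theta>\<in>(#) i ` paths_between l j. g \<theta>)"
    by (rule sum.UNION_disjoint) (auto simp: finite_paths_between, auto simp: paths_between_def)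
  also have "\<dots> = (\<Sum>l\<in>{l \<in> {1..<i}. linked i l}. \<Sum>\<theta>\<in>paths_between l j. g (i # \<theta>))"
    by (simp add: sum.reindex)
  finally show ?thesis .
qed

lemma sum_states: "(\<Sum>a\<in>states. g a) = (\<Sum>i\<in>{1..k}. \<Sum>a\<in>B i. g a)"
  unfolding states_def using finite_block disjoint_blocks by (intro sum.UNION_disjoint) auto

lemma resolvent_first_block:
  assumes i: "i \<in> {1..k}" and "a \<in> B i"
  shows "resolvent states A a b = (\<Sum>c\<in>B i. resolvent (B i) A a c *
    (of_bool (c = b) + fps_X * (\<Sum>l\<in>{l \<in> {1..<i}. linked i l}. \<Sum>e\<in>B l. fps_const (A c e) * resolvent states A e b)))"
proof (rule fps_linear_system_solution[OF finite_block[OF i] _ \<open>a \<in> B i\<close>])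
  fix a assume a: "a \<in> B i"
  let ?G = "\<lambda>l. \<Sum>e\<in>B l. fps_const (A a e) * resolvent states A e b"
  have "(\<Sum>l\<in>{1..k}. ?G l) = (\<Sum>l\<in>insert i {l \<in> {1..<i}. linked i l}. ?G l)"
  proof (rule sum.mono_neutral_right)
    show "\<forall>l\<in>{1..k} - insert i {l \<in> {1..<i}. linked i l}. ?G l = 0"
    proof
      fix l assume l: "l \<in> {1..k} - insert i {l \<in> {1..<i}. linked i l}"
      then consider "i < l" | "\<not> linked i l" by force
      then have "A a e = 0" if "e \<in> B l" for e
        using triangular[OF i _ _ a that] l a that by cases (auto simp: linked_def)
      then show "?G l = 0" by simp
    qed
  qed (use i in auto)
  then have "(\<Sum>e\<in>states. fps_const (A a e) * resolvent states A e b)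
      = ?G i + (\<Sum>l\<in>{l \<in> {1..<i}. linked i l}. ?G l)"
    unfolding sum_states by simp
  then show "resolvent states A a b = of_bool (a = b) + fps_X * (\<Sum>l\<in>{l \<in> {1..<i}. linked i l}. ?G l) + fps_X * ?G i"
    by (subst resolvent_unfold) (simp add: algebra_simps)
qed

lemma sum_path_resolvent_Cons:
  "(\<Sum>\<theta>\<in>paths_between l j. path_resolvent (i # \<theta>) a b) = (\<Sum>c\<in>B i. resolvent (B i) A a c *
    (fps_X * (\<Sum>e\<in>B l. fps_const (A c e) * (\<Sum>\<theta>\<in>paths_between l j. path_resolvent \<theta> e b))))"
proof -
  have path: "path_resolvent (i # \<theta>) a b = fps_X *
      (\<Sum>c\<in>B i. \<Sum>e\<in>B l. fps_const (A c e) * (resolvent (B i) A a c * path_resolvent \<theta> e b))"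
    if "\<theta> \<in> paths_between l j" for \<theta>
    using that by (cases \<theta>) (auto simp: paths_between_def paths_def)
  have "(\<Sum>\<theta>\<in>paths_between l j. path_resolvent (i # \<theta>) a b) = (\<Sum>\<theta>\<in>paths_between l j. fps_X *
      (\<Sum>c\<in>B i. \<Sum>e\<in>B l. fps_const (A c e) * (resolvent (B i) A a c * path_resolvent \<theta> e b)))"
    by (rule sum.cong[OF refl path])
  also have "\<dots> = fps_X * (\<Sum>c\<in>B i. \<Sum>e\<in>B l. \<Sum>\<theta>\<in>paths_between l j.
      fps_const (A c e) * (resolvent (B i) A a c * path_resolvent \<theta> e b))"
    by (simp only: sum_distrib_left[symmetric] sum.swap[of _ _ "paths_between l j"])
  finally show ?thesis by (simp add: sum_distrib_left mult.left_commute)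
qed

proposition resolvent_eq_sum_paths:
  assumes "i \<in> {1..k}" "a \<in> B i" and j: "j \<in> {1..k}" "b \<in> B j"
  shows "resolvent states A a b = (\<Sum>\<theta>\<in>paths_between i j. path_resolvent \<theta> a b)"
  using assms(1,2)
proof (induction i arbitrary: a rule: less_induct)
  case (less i)
  let ?R = "\<lambda>c. resolvent (B i) A a c" and ?L = "{l \<in> {1..<i}. linked i l}"
  define G where "G l c = (\<Sum>e\<in>B l. fps_const (A c e) * resolvent states A e b)" for l c
  have stay: "(\<Sum>c\<in>B i. ?R c * of_bool (c = b)) = (if i = j then path_resolvent [i] a b else 0)"
  proof (cases "i = j")
    case True
    then show ?thesis
      using j finite_block by (simp add: of_bool_def if_distrib cong: if_cong)
  next
    case False
    then have "c \<noteq> b" if "c \<in> B i" for c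
      using disjoint_blocks[of i j] less.prems(1) j that by blast
    then show ?thesis using False by simp
  qed
  have leave: "(\<Sum>c\<in>B i. ?R c * (fps_X * G l c)) = (\<Sum>\<theta>\<in>paths_between l j. path_resolvent (i # \<theta>) a b)"
    if "l \<in> ?L" for l
    using that less.IH[of l] less.prems(1) by (simp add: sum_path_resolvent_Cons G_def)
  have "resolvent states A a b = (\<Sum>c\<in>B i. ?R c * (of_bool (c = b) + fps_X * (\<Sum>l\<in>?L. G l c)))"
    unfolding G_def by (rule resolvent_first_block[OF less.prems])
  also have "\<dots> = (\<Sum>c\<in>B i. ?R c * of_bool (c = b)) + (\<Sum>l\<in>?L. \<Sum>c\<in>B i. ?R c * (fps_X * G l c))"
    unfolding distrib_left sum.distrib sum_distrib_left by (simp only: sum.swap[of _ "B i"])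
  also have "\<dots> = (\<Sum>\<theta>\<in>paths_between i j. path_resolvent \<theta> a b)"
    unfolding stay sum_paths_between[OF less.prems(1)] by (simp only: leave cong: sum.cong)
  finally show ?case .
qed

definition path_form :: "nat list \<Rightarrow> ('a \<Rightarrow> real) \<Rightarrow> ('a \<Rightarrow> real) \<Rightarrow> real fps" where
  "path_form \<theta> f g = (\<Sum>a\<in>B (hd \<theta>). \<Sum>b\<in>B (last \<theta>). fps_const (f a * g b) * path_resolvent \<theta> a b)"

lemma resolvent_form_eq_sum_paths:
  "resolvent_form states A f g = (\<Sum>\<theta>\<in>paths. path_form \<theta> f g)"
proof -
  have blocks: "(\<Sum>a\<in>B i. \<Sum>b\<in>B j. fps_const (f a * g b) * resolvent states A a b)
      = (\<Sum>\<theta>\<in>{\<theta> \<in> {\<theta> \<in> paths. hd \<theta> = i}. last \<theta> = j}. path_form \<theta> f g)"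
    if "i \<in> {1..k}" "j \<in> {1..k}" for i j
  proof -
    have "(\<Sum>a\<in>B i. \<Sum>b\<in>B j. fps_const (f a * g b) * resolvent states A a b)
        = (\<Sum>a\<in>B i. \<Sum>b\<in>B j. \<Sum>\<theta>\<in>paths_between i j. fps_const (f a * g b) * path_resolvent \<theta> a b)"
      by (intro sum.cong refl) (simp only: resolvent_eq_sum_paths[OF that(1) _ that(2)] sum_distrib_left)
    also have "\<dots> = (\<Sum>\<theta>\<in>paths_between i j. \<Sum>a\<in>B i. \<Sum>b\<in>B j. fps_const (f a * g b) * path_resolvent \<theta> a b)"
      by (simp only: sum.swap[of _ "paths_between i j"])
    finally show ?thesis by (simp add: paths_between_def path_form_def conj_assoc)
  qed
  have "resolvent_form states A f g
      = (\<Sum>i\<in>{1..k}. \<Sum>j\<in>{1..k}. \<Sum>a\<in>B i. \<Sum>b\<in>B j. fps_const (f a * g b) * resolvent states A a b)"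
    unfolding resolvent_form_def sum_states by (intro sum.cong refl sum.swap)
  also have "\<dots> = (\<Sum>i\<in>{1..k}. \<Sum>j\<in>{1..k}. \<Sum>\<theta>\<in>{\<theta> \<in> {\<theta> \<in> paths. hd \<theta> = i}. last \<theta> = j}. path_form \<theta> f g)"
    by (intro sum.cong refl blocks)
  also have "\<dots> = (\<Sum>i\<in>{1..k}. \<Sum>\<theta>\<in>{\<theta> \<in> paths. hd \<theta> = i}. path_form \<theta> f g)"
    using finite_paths paths_ends by (intro sum.cong refl sum.group) auto
  also have "\<dots> = (\<Sum>\<theta>\<in>paths. path_form \<theta> f g)"
    using finite_paths paths_ends by (intro sum.group) auto
  finally show ?thesis .
qed

lemma append_in_paths_iff:
  "\<theta> @ l # \<theta>' \<in> paths \<longleftrightarrow> \<theta> @ [l] \<in> paths \<and> l # \<theta>' \<in> paths"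
proof -
  have "sorted_wrt (>) (\<theta> @ l # \<theta>') \<longleftrightarrow> sorted_wrt (>) (\<theta> @ [l]) \<and> sorted_wrt (>) (l # \<theta>')"
    unfolding sorted_wrt_append by auto (meson less_trans)
  moreover have "successively linked (\<theta> @ l # \<theta>') \<longleftrightarrow>
      successively linked (\<theta> @ [l]) \<and> successively linked (l # \<theta>')"
    unfolding successively_append_iff by auto
  ultimately show ?thesis unfolding paths_def by auto
qed

lemma bij_betw_glue_paths:
  "bij_betw (\<lambda>(\<theta>, \<theta>'). \<theta> @ tl \<theta>') ({\<theta> \<in> paths. last \<theta> = l} \<times> {\<theta> \<in> paths. hd \<theta> = l}) {\<theta> \<in> paths. l \<in> set \<theta>}"
  unfolding bij_betw_def
proof (intro conjI Set.set_eqI iffI)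
  have ends: "\<exists>\<eta> \<eta>'. \<theta> = \<eta> @ [l] \<and> \<theta>' = l # \<eta>' \<and> l \<notin> set \<eta> \<and> l \<notin> set \<eta>'"
    if "\<theta> \<in> paths" "last \<theta> = l" "\<theta>' \<in> paths" "hd \<theta>' = l" for \<theta> \<theta>'
    using that strictly_decreasing_imp_distinct[of \<theta>] strictly_decreasing_imp_distinct[of \<theta>']
    by (cases \<theta> rule: rev_cases; cases \<theta>') (auto simp: paths_def)
  show "inj_on (\<lambda>(\<theta>, \<theta>'). \<theta> @ tl \<theta>') ({\<theta> \<in> paths. last \<theta> = l} \<times> {\<theta> \<in> paths. hd \<theta> = l})"
  proof (rule inj_onI)
    fix p q
    assume "p \<in> {\<theta> \<in> paths. last \<theta> = l} \<times> {\<theta> \<in> paths. hd \<theta> = l}"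
      and "q \<in> {\<theta> \<in> paths. last \<theta> = l} \<times> {\<theta> \<in> paths. hd \<theta> = l}"
      and eq: "(\<lambda>(\<theta>, \<theta>'). \<theta> @ tl \<theta>') p = (\<lambda>(\<theta>, \<theta>'). \<theta> @ tl \<theta>') q"
    then obtain \<eta> \<eta>' \<zeta> \<zeta>' where "p = (\<eta> @ [l], l # \<eta>')" "q = (\<zeta> @ [l], l # \<zeta>')"
      "l \<notin> set \<eta>" "l \<notin> set \<eta>'"
      using ends by (cases p; cases q) blast
    with eq show "p = q" by (simp add: append_Cons_eq_iff)
  qed
  fix \<theta>
  {
    assume "\<theta> \<in> (\<lambda>(\<theta>, \<theta>'). \<theta> @ tl \<theta>') ` ({\<theta> \<in> paths. last \<theta> = l} \<times> {\<theta> \<in> paths. hd \<theta> = l})"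
    then obtain \<zeta> \<zeta>' where "\<theta> = \<zeta> @ tl \<zeta>'" "\<zeta> \<in> paths" "last \<zeta> = l" "\<zeta>' \<in> paths" "hd \<zeta>' = l" by auto
    moreover from ends[OF this(2-5)] obtain \<eta> \<eta>' where "\<zeta> = \<eta> @ [l]" "\<zeta>' = l # \<eta>'" by blast
    ultimately have "\<theta> = \<eta> @ l # \<eta>'" "\<eta> @ [l] \<in> paths" "l # \<eta>' \<in> paths" by simp_all
    then show "\<theta> \<in> {\<theta> \<in> paths. l \<in> set \<theta>}" using append_in_paths_iff[of \<eta> l \<eta>'] by simp
  next
    assume "\<theta> \<in> {\<theta> \<in> paths. l \<in> set \<theta>}"
    moreover from this obtain \<eta> \<eta>' where "\<theta> = \<eta> @ l # \<eta>'" using split_list by fast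
    ultimately show "\<theta> \<in> (\<lambda>(\<theta>, \<theta>'). \<theta> @ tl \<theta>') ` ({\<theta> \<in> paths. last \<theta> = l} \<times> {\<theta> \<in> paths. hd \<theta> = l})"
      using append_in_paths_iff[of \<eta> l \<eta>'] by (intro image_eqI[of _ _ "(\<eta> @ [l], l # \<eta>')"]) simp_all
  }
qed

end

text \<open>\<open>ord i\<close> is the order of the pole contributed by block \<open>i\<close>, and \<open>mass i\<close> the factor by which its
  constant differs from \<open>v u\<^sup>T\<close>: one for a maximal block, the sum of a geometric series otherwise.\<close>
locale perron_block_triangular = block_triangular A B k
  for A :: "'a \<Rightarrow> 'a \<Rightarrow> real" and B :: "nat \<Rightarrow> 'a set" and k :: nat +
  fixes v u :: "nat \<Rightarrow> 'a \<Rightarrow> real" and ord :: "nat \<Rightarrow> nat" and mass :: "nat \<Rightarrow> real"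
  assumes block_growth: "\<And>i a b. i \<in> {1..k} \<Longrightarrow> a \<in> B i \<Longrightarrow> b \<in> B i \<Longrightarrow>
    pole_growth (ord i) (v i a * mass i * u i b) (resolvent (B i) A a b)"
begin

definition link :: "nat \<Rightarrow> nat \<Rightarrow> real" where
  "link i j = (\<Sum>a\<in>B i. \<Sum>b\<in>B j. u i a * A a b * v j b)"

fun path_const :: "nat list \<Rightarrow> real" where
  "path_const [] = 0"
| "path_const [i] = mass i"
| "path_const (i # j # \<theta>) = mass i * link i j * path_const (j # \<theta>)"

definition path_ord :: "nat list \<Rightarrow> nat" where
  "path_ord \<theta> = (\<Sum>i\<leftarrow>\<theta>. ord i)"

definition path_limit :: "('a \<Rightarrow> real) \<Rightarrow> ('a \<Rightarrow> real) \<Rightarrow> nat list \<Rightarrow> real" where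
  "path_limit f g \<theta> = (\<Sum>a\<in>B (hd \<theta>). f a * v (hd \<theta>) a) * path_const \<theta> * (\<Sum>b\<in>B (last \<theta>). u (last \<theta>) b * g b)"

lemma path_resolvent_growth:
  assumes "\<theta> \<noteq> []" "set \<theta> \<subseteq> {1..k}" "a \<in> B (hd \<theta>)" "b \<in> B (last \<theta>)"
  shows "pole_growth (path_ord \<theta>) (v (hd \<theta>) a * path_const \<theta> * u (last \<theta>) b) (path_resolvent \<theta> a b)"
  using assms
proof (induction \<theta> arbitrary: a rule: induct_list012)
  case (2 i)
  then show ?case using block_growth[of i a b] by (simp add: path_ord_def)
next
  case (3 i j \<theta>)
  let ?K = "path_const (j # \<theta>) * u (last (j # \<theta>)) b"
  have "pole_growth (ord i + path_ord (j # \<theta>))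
      (\<Sum>c\<in>B i. \<Sum>e\<in>B j. A c e * ((v i a * mass i * u i c) * (v j e * ?K)))
      (path_resolvent (i # j # \<theta>) a b)"
    unfolding path_resolvent.simps using 3
    by (intro pole_growth_fps_X_mult pole_growth_sum pole_growth_cmult pole_growth_mult block_growth)
       (auto simp: mult.assoc)
  also have "(\<Sum>c\<in>B i. \<Sum>e\<in>B j. A c e * ((v i a * mass i * u i c) * (v j e * ?K)))
      = v i a * (mass i * link i j * path_const (j # \<theta>)) * u (last (j # \<theta>)) b"
    by (simp add: link_def sum_distrib_left sum_distrib_right mult_ac)
  finally show ?case by (simp add: path_ord_def)
qed simp

lemma path_form_growth:
  assumes "\<theta> \<in> paths"
  shows "pole_growth (path_ord \<theta>) (path_limit f g \<theta>) (path_form \<theta> f g)"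
proof -
  have "pole_growth (path_ord \<theta>)
      (\<Sum>a\<in>B (hd \<theta>). \<Sum>b\<in>B (last \<theta>). f a * g b * (v (hd \<theta>) a * path_const \<theta> * u (last \<theta>) b)) (path_form \<theta> f g)"
    unfolding path_form_def using assms
    by (intro pole_growth_sum pole_growth_cmult path_resolvent_growth) (auto simp: paths_def)
  then show ?thesis
    by (simp add: path_limit_def sum_distrib_left sum_distrib_right mult_ac sum.swap[of _ "B (last \<theta>)"])
qed

proposition resolvent_form_growth:
  assumes "\<And>\<theta>. \<theta> \<in> paths \<Longrightarrow> path_ord \<theta> \<le> h"
  shows "pole_growth h (\<Sum>\<theta>\<in>{\<theta> \<in> paths. path_ord \<theta> = h}. path_limit f g \<theta>) (resolvent_form states A f g)"
  unfolding resolvent_form_eq_sum_paths sum.inter_filter[OF finite_paths]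
  by (intro pole_growth_sum pole_growth_top_order path_form_growth assms)

lemma path_ord_glue: "path_ord (\<theta> @ [l]) + path_ord (l # \<theta>') = path_ord (\<theta> @ l # \<theta>') + ord l"
  by (simp add: path_ord_def)

lemma path_const_glue: "path_const (\<theta> @ [l]) * path_const (l # \<theta>') = mass l * path_const (\<theta> @ l # \<theta>')"
  by (induction \<theta> rule: induct_list012) (simp_all add: mult_ac)

lemma path_limit_glue:
  assumes "finite (B l)" "s \<in> B l"
  shows "path_limit f (\<lambda>b. of_bool (b = s)) (\<theta> @ [l]) * path_limit (\<lambda>a. of_bool (a = s)) g (l # \<theta>')
    = u l s * v l s * mass l * path_limit f g (\<theta> @ l # \<theta>')"
proof -
  have "hd (\<theta> @ l # \<theta>') = hd (\<theta> @ [l])" by (cases \<theta>) auto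
  then show ?thesis
    using assms path_const_glue[of \<theta> l \<theta>']
    by (simp add: path_limit_def of_bool_def if_distrib if_distribR mult_ac cong: if_cong)
qed

lemma path_form_eq_0_if_hd: "(\<And>a. a \<in> B (hd \<theta>) \<Longrightarrow> f a = 0) \<Longrightarrow> path_form \<theta> f g = 0"
  and path_form_eq_0_if_last: "(\<And>b. b \<in> B (last \<theta>) \<Longrightarrow> g b = 0) \<Longrightarrow> path_form \<theta> f g = 0"
  by (simp_all add: path_form_def)

lemma resolvent_form_indicator_right:
  assumes "l \<in> {1..k}" "s \<in> B l"
  shows "resolvent_form states A f (\<lambda>b. of_bool (b = s))
    = (\<Sum>\<theta>\<in>{\<theta> \<in> paths. last \<theta> = l}. path_form \<theta> f (\<lambda>b. of_bool (b = s)))"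
  unfolding resolvent_form_eq_sum_paths
proof (rule sum.mono_neutral_right[OF finite_paths], blast, rule ballI, rule path_form_eq_0_if_last)
  fix \<theta> b assume "\<theta> \<in> paths - {\<theta> \<in> paths. last \<theta> = l}" "b \<in> B (last \<theta>)"
  then show "of_bool (b = s) = (0 :: real)"
    using disjoint_blocks[of "last \<theta>" l] paths_ends[of \<theta>] assms by auto
qed

lemma resolvent_form_indicator_left:
  assumes "l \<in> {1..k}" "s \<in> B l"
  shows "resolvent_form states A (\<lambda>a. of_bool (a = s)) g
    = (\<Sum>\<theta>\<in>{\<theta> \<in> paths. hd \<theta> = l}. path_form \<theta> (\<lambda>a. of_bool (a = s)) g)"
  unfolding resolvent_form_eq_sum_paths
proof (rule sum.mono_neutral_right[OF finite_paths], blast, rule ballI, rule path_form_eq_0_if_hd)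
  fix \<theta> a assume "\<theta> \<in> paths - {\<theta> \<in> paths. hd \<theta> = l}" "a \<in> B (hd \<theta>)"
  then show "of_bool (a = s) = (0 :: real)"
    using disjoint_blocks[of "hd \<theta>" l] paths_ends[of \<theta>] assms by auto
qed

proposition visit_growth:
  assumes bound: "\<And>\<theta>. \<theta> \<in> paths \<Longrightarrow> path_ord \<theta> \<le> h"
    and l: "l \<in> {1..k}" "s \<in> B l"
  shows "pole_growth (h + ord l)
    (u l s * v l s * mass l * (\<Sum>\<theta>\<in>{\<theta> \<in> paths. l \<in> set \<theta> \<and> path_ord \<theta> = h}. path_limit f g \<theta>))
    (resolvent_form states A f (\<lambda>b. of_bool (b = s)) * resolvent_form states A (\<lambda>a. of_bool (a = s)) g)"
proof -
  let ?c = "u l s * v l s * mass l" and ?glue = "\<lambda>(\<theta>, \<theta>'). \<theta> @ tl \<theta>'"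
  let ?pairs = "{\<theta> \<in> paths. last \<theta> = l} \<times> {\<theta> \<in> paths. hd \<theta> = l}"
  let ?top = "\<lambda>\<theta>. if path_ord \<theta> = h then ?c * path_limit f g \<theta> else 0"
  have pair: "pole_growth (h + ord l) (?top (\<theta> @ tl \<theta>'))
      (path_form \<theta> f (\<lambda>b. of_bool (b = s)) * path_form \<theta>' (\<lambda>a. of_bool (a = s)) g)"
    if "(\<theta>, \<theta>') \<in> ?pairs" for \<theta> \<theta>'
  proof -
    obtain \<eta> \<eta>' where \<eta>: "\<theta> = \<eta> @ [l]" "\<theta>' = l # \<eta>'"
      using \<open>(\<theta>, \<theta>') \<in> ?pairs\<close> by (cases \<theta> rule: rev_cases; cases \<theta>') (auto simp: paths_def)
    then have glue: "\<theta> @ tl \<theta>' = \<eta> @ l # \<eta>'" by simp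
    have "path_ord (\<eta> @ l # \<eta>') \<le> h"
      using \<open>(\<theta>, \<theta>') \<in> ?pairs\<close> \<eta> append_in_paths_iff[of \<eta> l \<eta>'] by (intro bound) simp
    then have le: "path_ord \<theta> + path_ord \<theta>' \<le> h + ord l"
      unfolding \<eta> path_ord_glue by simp
    have "pole_growth (path_ord \<theta> + path_ord \<theta>')
        (path_limit f (\<lambda>b. of_bool (b = s)) \<theta> * path_limit (\<lambda>a. of_bool (a = s)) g \<theta>')
        (path_form \<theta> f (\<lambda>b. of_bool (b = s)) * path_form \<theta>' (\<lambda>a. of_bool (a = s)) g)"
      using \<open>(\<theta>, \<theta>') \<in> ?pairs\<close> by (intro pole_growth_mult path_form_growth) auto
    from pole_growth_top_order[OF this le] show ?thesis
      unfolding glue unfolding \<eta> path_ord_glue path_limit_glue[OF finite_block[OF l(1)] l(2)]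
      by (simp split del: if_split)
  qed
  have "resolvent_form states A f (\<lambda>b. of_bool (b = s)) * resolvent_form states A (\<lambda>a. of_bool (a = s)) g
      = (\<Sum>(\<theta>, \<theta>')\<in>?pairs. path_form \<theta> f (\<lambda>b. of_bool (b = s)) * path_form \<theta>' (\<lambda>a. of_bool (a = s)) g)"
    unfolding resolvent_form_indicator_right[OF l] resolvent_form_indicator_left[OF l]
    by (simp add: sum_product sum.cartesian_product)
  moreover have "(\<Sum>p\<in>?pairs. ?top (?glue p)) = (\<Sum>\<theta>\<in>{\<theta> \<in> paths. l \<in> set \<theta>}. ?top \<theta>)"
    by (rule sum.reindex_bij_betw[OF bij_betw_glue_paths])
  moreover have "\<dots> = ?c * (\<Sum>\<theta>\<in>{\<theta> \<in> paths. l \<in> set \<theta> \<and> path_ord \<theta> = h}. path_limit f g \<theta>)"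
    using finite_paths by (simp add: sum.inter_filter[symmetric] sum_distrib_left conj_assoc)
  moreover have "pole_growth (h + ord l) (\<Sum>p\<in>?pairs. ?top (?glue p))
      (\<Sum>(\<theta>, \<theta>')\<in>?pairs. path_form \<theta> f (\<lambda>b. of_bool (b = s)) * path_form \<theta>' (\<lambda>a. of_bool (a = s)) g)"
    by (intro pole_growth_sum) (use pair in \<open>simp only: split_paired_all prod.case\<close>)
  ultimately show ?thesis by simp
qed

end

section \<open>Generalised eigenspaces and left eigenvectors\<close>

lemma index_mult_mat_vec_sum:
  assumes "A \<in> carrier_mat nr nc" "x \<in> carrier_vec nc" "i < nr"
  shows "(A *\<^sub>v x) $ i = (\<Sum>j<nc. A $$ (i, j) * x $ j)"
  using assms by (simp add: scalar_prod_def lessThan_atLeast0)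

lemma index_transpose_mult_vec_sum:
  fixes A :: "'a::comm_semiring_0 mat"
  assumes "A \<in> carrier_mat nr nc" "x \<in> carrier_vec nr" "j < nc"
  shows "(transpose_mat A *\<^sub>v x) $ j = (\<Sum>i<nr. x $ i * A $$ (i, j))"
  using assms by (simp add: scalar_prod_def lessThan_atLeast0 mult.commute)

lemma mult_zero_vec: "A \<in> carrier_mat nr nc \<Longrightarrow> A *\<^sub>v 0\<^sub>v nc = (0\<^sub>v nr :: 'a::semiring_0 vec)"
  by (intro eq_vecI) auto

lemma scalar_prod_sum_right:
  assumes "u \<in> carrier_vec n" "\<And>i. i \<in> I \<Longrightarrow> f i \<in> carrier_vec n"
  shows "u \<bullet> vec n (\<lambda>j. \<Sum>i\<in>I. f i $ j) = (\<Sum>i\<in>I. u \<bullet> f i)"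
proof -
  have "u \<bullet> vec n (\<lambda>j. \<Sum>i\<in>I. f i $ j) = (\<Sum>j<n. \<Sum>i\<in>I. u $ j * f i $ j)"
    by (simp add: scalar_prod_def sum_distrib_left lessThan_atLeast0)
  also have "\<dots> = (\<Sum>i\<in>I. \<Sum>j<n. u $ j * f i $ j)" by (rule sum.swap)
  also have "\<dots> = (\<Sum>i\<in>I. u \<bullet> f i)"
  proof (rule sum.cong[OF refl])
    fix i assume "i \<in> I"
    then show "(\<Sum>j<n. u $ j * f i $ j) = u \<bullet> f i"
      using carrier_vecD[OF assms(2)] by (simp add: scalar_prod_def lessThan_atLeast0)
  qed
  finally show ?thesis .
qed

lemma mult_mat_vec_sum:
  assumes "A \<in> carrier_mat nr nc" "\<And>i. i \<in> I \<Longrightarrow> f i \<in> carrier_vec nc"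
  shows "A *\<^sub>v vec nc (\<lambda>j. \<Sum>i\<in>I. f i $ j) = vec nr (\<lambda>j. \<Sum>i\<in>I. (A *\<^sub>v f i) $ j)"
  using assms by (intro eq_vecI) (auto simp: scalar_prod_sum_right)

lemma char_matrix_mult_vec:
  assumes "A \<in> carrier_mat n n" "x \<in> carrier_vec n"
  shows "char_matrix A \<mu> *\<^sub>v x = A *\<^sub>v x - \<mu> \<cdot>\<^sub>v x"
  using assms
  by (intro eq_vecI) (auto simp: char_matrix_def add_scalar_prod_distrib[where n = n] row_add)

lemma char_matrix_eq_minus: "A \<in> carrier_mat n n \<Longrightarrow> char_matrix A \<mu> = A - \<mu> \<cdot>\<^sub>m 1\<^sub>m n"
  by (intro eq_matI) (auto simp: char_matrix_def)

lemma pow_mat_Suc_mult_vec: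
  assumes "A \<in> carrier_mat n n" "x \<in> carrier_vec n"
  shows "(A ^\<^sub>m Suc m) *\<^sub>v x = (A ^\<^sub>m m) *\<^sub>v (A *\<^sub>v x)"
  using assoc_mult_mat_vec[OF pow_carrier_mat[OF assms(1)] assms] by simp

context
  fixes A :: "complex mat" and n :: nat
  assumes A: "A \<in> carrier_mat n n"
begin

lemma char_matrix_carrier [simp]: "char_matrix A \<mu> \<in> carrier_mat n n"
  using A by (rule char_matrix_closed)

lemma char_matrix_mult_carrier [simp]: "char_matrix A \<mu> *\<^sub>v x \<in> carrier_vec n"
  using carrier_matD(1)[OF char_matrix_carrier] by (intro carrier_vecI) simp

lemma char_matrix_mult_zero [simp]: "char_matrix A \<mu> *\<^sub>v 0\<^sub>v n = 0\<^sub>v n"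
  by (rule mult_zero_vec) simp

lemma gen_eigenspace_iff:
  "x \<in> gen_eigenspace A \<mu> \<longleftrightarrow> x \<in> carrier_vec n \<and> (\<exists>m. (char_matrix A \<mu> ^\<^sub>m m) *\<^sub>v x = 0\<^sub>v n)"
  using A by (simp add: gen_eigenspace_def char_matrix_eq_minus)

lemma gen_eigenspace_carrier: "x \<in> gen_eigenspace A \<mu> \<Longrightarrow> x \<in> carrier_vec n"
  by (simp add: gen_eigenspace_iff)

lemma zero_in_gen_eigenspace: "0\<^sub>v n \<in> gen_eigenspace A \<mu>"
  using mult_zero_vec[OF pow_carrier_mat[OF char_matrix_carrier]] by (auto simp: gen_eigenspace_iff)

lemma gen_eigenspace_if_char_matrix:
  assumes "x \<in> carrier_vec n" "char_matrix A \<mu> *\<^sub>v x \<in> gen_eigenspace A \<mu>"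
  shows "x \<in> gen_eigenspace A \<mu>"
  using assms pow_mat_Suc_mult_vec[OF char_matrix_carrier assms(1)]
  unfolding gen_eigenspace_iff by metis

lemma gen_eigenspace_induct [consumes 1, case_names zero step]:
  assumes "x \<in> gen_eigenspace A \<mu>" "P (0\<^sub>v n)"
    and step: "\<And>x. x \<in> carrier_vec n \<Longrightarrow> char_matrix A \<mu> *\<^sub>v x \<in> gen_eigenspace A \<mu> \<Longrightarrow>
      P (char_matrix A \<mu> *\<^sub>v x) \<Longrightarrow> P x"
  shows "P x"
proof -
  obtain m where "x \<in> carrier_vec n" "(char_matrix A \<mu> ^\<^sub>m m) *\<^sub>v x = 0\<^sub>v n"
    using assms(1) by (auto simp: gen_eigenspace_iff)
  then show ?thesis
  proof (induction m arbitrary: x)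
    case 0
    then have "x = 0\<^sub>v n" using A by (simp add: char_matrix_def)
    then show ?case using assms(2) by simp
  next
    case (Suc m)
    let ?y = "char_matrix A \<mu> *\<^sub>v x"
    have y: "?y \<in> carrier_vec n" "(char_matrix A \<mu> ^\<^sub>m m) *\<^sub>v ?y = 0\<^sub>v n"
      using Suc.prems pow_mat_Suc_mult_vec[OF char_matrix_carrier Suc.prems(1)] by simp_all
    show ?case
    proof (rule step[OF Suc.prems(1)])
      show "?y \<in> gen_eigenspace A \<mu>" using y unfolding gen_eigenspace_iff by blast
      show "P ?y" using y by (rule Suc.IH)
    qed
  qed
qed

lemma gen_eigenspace_smult:
  assumes "x \<in> gen_eigenspace A \<mu>"
  shows "c \<cdot>\<^sub>v x \<in> gen_eigenspace A \<mu>"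
  using assms
proof (induction rule: gen_eigenspace_induct)
  case zero
  have "c \<cdot>\<^sub>v 0\<^sub>v n = 0\<^sub>v n" by (intro eq_vecI) auto
  then show ?case using zero_in_gen_eigenspace by simp
next
  case (step x)
  then show ?case
    by (auto simp: mult_mat_vec[OF char_matrix_carrier] intro!: gen_eigenspace_if_char_matrix[of "c \<cdot>\<^sub>v x"])
qed

lemma gen_eigenspace_char_matrix:
  assumes "x \<in> gen_eigenspace A \<mu>"
  shows "char_matrix A \<mu> *\<^sub>v x \<in> gen_eigenspace A \<mu>"
  using assms by (induction rule: gen_eigenspace_induct) (auto simp: zero_in_gen_eigenspace)

lemma gen_eigenspace_minus:
  assumes "x \<in> gen_eigenspace A \<mu>" "y \<in> gen_eigenspace A \<mu>"
  shows "x - y \<in> gen_eigenspace A \<mu>"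
  using assms
proof (induction arbitrary: y rule: gen_eigenspace_induct)
  case zero
  then have "0\<^sub>v n - y = (-1) \<cdot>\<^sub>v y" by (intro eq_vecI) (auto simp: gen_eigenspace_iff)
  then show ?case using gen_eigenspace_smult[OF zero] by simp
next
  case (step x)
  have "char_matrix A \<mu> *\<^sub>v (x - y) = char_matrix A \<mu> *\<^sub>v x - char_matrix A \<mu> *\<^sub>v y"
    using step.hyps(1) gen_eigenspace_carrier[OF step.prems]
    by (rule mult_minus_distrib_mat_vec[OF char_matrix_carrier])
  then show ?case
    using step gen_eigenspace_carrier gen_eigenspace_char_matrix
    by (auto intro!: gen_eigenspace_if_char_matrix[of "x - y"])
qed

lemma char_matrix_surj_on_gen_eigenspace:
  assumes "x \<in> gen_eigenspace A \<mu>" "a \<noteq> \<mu>"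
  shows "\<exists>y\<in>gen_eigenspace A \<mu>. char_matrix A a *\<^sub>v y = x"
  using assms(1)
proof (induction rule: gen_eigenspace_induct)
  case zero
  show ?case using zero_in_gen_eigenspace by (intro bexI[of _ "0\<^sub>v n"]) auto
next
  case (step x)
  then obtain y where y: "y \<in> gen_eigenspace A \<mu>" "char_matrix A a *\<^sub>v y = char_matrix A \<mu> *\<^sub>v x"
    by blast
  note carrier = step.hyps(1) gen_eigenspace_carrier[OF y(1)]
  let ?z = "(1 / (\<mu> - a)) \<cdot>\<^sub>v (x - y)"
  have "x \<in> gen_eigenspace A \<mu>" using step.hyps by (rule gen_eigenspace_if_char_matrix)
  then have "?z \<in> gen_eigenspace A \<mu>" using y(1) by (intro gen_eigenspace_smult gen_eigenspace_minus)
  moreover have "char_matrix A a *\<^sub>v ?z = x"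
  proof -
    have "char_matrix A a *\<^sub>v ?z = (1 / (\<mu> - a)) \<cdot>\<^sub>v (char_matrix A a *\<^sub>v x - char_matrix A \<mu> *\<^sub>v x)"
      using carrier A
      by (simp add: mult_mat_vec[OF char_matrix_carrier] mult_minus_distrib_mat_vec[OF char_matrix_carrier] y(2))
    also have "\<dots> = x"
      unfolding char_matrix_mult_vec[OF A carrier(1)]
      using A carrier \<open>a \<noteq> \<mu>\<close> by (intro eq_vecI) (auto simp: field_simps)
    finally show ?thesis .
  qed
  ultimately show ?case by blast
qed

definition gen_eigenspace_sum :: "complex set \<Rightarrow> complex vec set" where
  "gen_eigenspace_sum E = {vec n (\<lambda>j. \<Sum>\<mu>\<in>E. f \<mu> $ j) | f. \<forall>\<mu>. f \<mu> \<in> gen_eigenspace A \<mu>}"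

lemma other_gen_eigenspaces_eq_sum: "other_gen_eigenspaces A \<rho> = gen_eigenspace_sum (spectrum A - {\<rho>})"
proof -
  have E: "{\<mu>. eigenvalue A \<mu> \<and> \<mu> \<noteq> \<rho>} = spectrum A - {\<rho>}" by (auto simp: spectrum_def)
  have "x \<in> carrier_vec n \<and> (\<forall>j<n. x $ j = g j) \<longleftrightarrow> x = vec n g" for x :: "complex vec" and g
    by (auto simp: vec_eq_iff)
  then show ?thesis
    using A unfolding other_gen_eigenspaces_def gen_eigenspace_sum_def E by auto
qed

lemma gen_eigenspace_sum_if_char_matrix:
  assumes "finite E" "a \<in> E" and x: "x \<in> carrier_vec n" and "char_matrix A a *\<^sub>v x \<in> gen_eigenspace_sum E"
  shows "x \<in> gen_eigenspace_sum E"
proof -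
  obtain f where f: "\<And>\<mu>. f \<mu> \<in> gen_eigenspace A \<mu>"
    and sum_f: "char_matrix A a *\<^sub>v x = vec n (\<lambda>j. \<Sum>\<mu>\<in>E. f \<mu> $ j)"
    using assms(4) by (auto simp: gen_eigenspace_sum_def)
  have "\<forall>\<mu>. \<exists>y. \<mu> \<noteq> a \<longrightarrow> y \<in> gen_eigenspace A \<mu> \<and> char_matrix A a *\<^sub>v y = f \<mu>"
    using char_matrix_surj_on_gen_eigenspace[OF f] by metis
  then obtain g where g: "\<And>\<mu>. \<mu> \<noteq> a \<Longrightarrow> g \<mu> \<in> gen_eigenspace A \<mu>"
    and char_g: "\<And>\<mu>. \<mu> \<noteq> a \<Longrightarrow> char_matrix A a *\<^sub>v g \<mu> = f \<mu>"
    by metis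
  define s where "s = vec n (\<lambda>j. \<Sum>\<mu>\<in>E - {a}. g \<mu> $ j)"
  have "char_matrix A a *\<^sub>v s = vec n (\<lambda>j. \<Sum>\<mu>\<in>E - {a}. (char_matrix A a *\<^sub>v g \<mu>) $ j)"
    unfolding s_def using g gen_eigenspace_carrier by (intro mult_mat_vec_sum[OF char_matrix_carrier]) auto
  also have "\<dots> = vec n (\<lambda>j. \<Sum>\<mu>\<in>E - {a}. f \<mu> $ j)"
    by (intro arg_cong[where f = "vec n"] ext sum.cong) (simp_all add: char_g)
  finally have char_s: "char_matrix A a *\<^sub>v s = vec n (\<lambda>j. \<Sum>\<mu>\<in>E - {a}. f \<mu> $ j)" .
  have "char_matrix A a *\<^sub>v (x - s) = char_matrix A a *\<^sub>v x - char_matrix A a *\<^sub>v s"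
    using x by (intro mult_minus_distrib_mat_vec[OF char_matrix_carrier]) (auto simp: s_def)
  also have "\<dots> = f a"
    unfolding sum_f char_s using assms(1,2) carrier_vecD[OF gen_eigenspace_carrier[OF f]]
    by (intro eq_vecI) (auto simp: sum.remove)
  finally have "x - s \<in> gen_eigenspace A a"
    using f x by (intro gen_eigenspace_if_char_matrix[of "x - s"]) (auto simp: s_def)
  moreover have "x = vec n (\<lambda>j. \<Sum>\<mu>\<in>E. (g(a := x - s)) \<mu> $ j)"
    using assms(1,2) x by (intro eq_vecI) (auto simp: s_def sum.remove)
  ultimately show ?thesis
    using g unfolding gen_eigenspace_sum_def by (intro CollectI exI[of _ "g(a := x - s)"]) auto
qed

lemma finite_spectrum: "finite (spectrum A)"
  using card_finite_spectrum(1)[OF A] .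

lemma upper_triangular_char_matrix_mult_eq_0:
  fixes T :: "complex mat"
  assumes T: "T \<in> carrier_mat n n" "upper_triangular T" and y: "y \<in> carrier_vec n"
    and support: "\<And>j. m < j \<Longrightarrow> j < n \<Longrightarrow> y $ j = 0" and i: "m \<le> i" "i < n"
  shows "(char_matrix T (T $$ (m, m)) *\<^sub>v y) $ i = 0"
proof -
  have "(T *\<^sub>v y) $ i = (\<Sum>j<n. T $$ (i, j) * y $ j)"
    using T i y by (simp add: scalar_prod_def lessThan_atLeast0)
  also have "\<dots> = (\<Sum>j\<in>{m}. T $$ (i, j) * y $ j)"
  proof (rule sum.mono_neutral_right)
    have "T $$ (i, j) * y $ j = 0" if "j < n" "j \<noteq> m" for j
      using that T i support[of j] by (cases "j < i") (auto simp: upper_triangular_def)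
    then show "\<forall>j\<in>{..<n} - {m}. T $$ (i, j) * y $ j = 0" by auto
  qed (use i in auto)
  also have "\<dots> = T $$ (m, m) * y $ i"
    using T i support[of i] by (cases "i = m") (auto simp: upper_triangular_def)
  finally show ?thesis
    using T y i by (simp add: char_matrix_mult_vec[OF T(1) y] del: index_mult_mat_vec)
qed

lemma upper_triangular_similar_diag_in_spectrum:
  assumes "T \<in> carrier_mat n n" "upper_triangular T" "similar_mat A T" "m < n"
  shows "T $$ (m, m) \<in> spectrum A"
proof -
  have "char_poly A = (\<Prod>a\<leftarrow>diag_mat T. [:- a, 1:])"
    using char_poly_similar[OF assms(3)] char_poly_upper_triangular[OF assms(1,2)] by simp
  then show ?thesis
    using assms(1,4)
    by (auto simp: spectrum_root_char_poly[OF A] poly_prod_list prod_list_zero_iff diag_mat_def)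
qed

lemma char_matrix_similar_mult_vec:
  assumes "P \<in> carrier_mat n n" "T \<in> carrier_mat n n" "A * P = P * T" "y \<in> carrier_vec n"
  shows "char_matrix A \<mu> *\<^sub>v (P *\<^sub>v y) = P *\<^sub>v (char_matrix T \<mu> *\<^sub>v y)"
proof -
  have "P *\<^sub>v (T *\<^sub>v y) = A *\<^sub>v (P *\<^sub>v y)"
    using assms(3) assoc_mult_mat_vec[OF assms(1,2,4)] assoc_mult_mat_vec[OF A assms(1,4)] by simp
  then show ?thesis
    unfolding char_matrix_mult_vec[OF assms(2,4)] char_matrix_mult_vec[OF A mult_mat_vec_carrier[OF assms(1,4)]]
    using mult_minus_distrib_mat_vec[OF assms(1) mult_mat_vec_carrier[OF assms(2,4)], of "\<mu> \<cdot>\<^sub>v y"]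
      mult_mat_vec[OF assms(1,4)] assms(4) by simp
qed

text \<open>Induction on the support of the vector in coordinates in which \<open>A\<close> is upper triangular.\<close>
lemma gen_eigenspace_sum_spectrum:
  assumes "x \<in> carrier_vec n"
  shows "x \<in> gen_eigenspace_sum (spectrum A)"
proof -
  obtain T where T: "T \<in> carrier_mat n n" "upper_triangular T" "similar_mat A T"
    using char_poly_factorized[OF A] schur_decomposition_exists[OF A] by metis
  then obtain P P' where "similar_mat_wit A T P P'" by (auto simp: similar_mat_def)
  note P = similar_mat_witD2[OF A this]
  have AP: "A * P = P * T"
    unfolding P(3) assoc_mult_mat[OF mult_carrier_mat[OF P(6) T(1)] P(7,6)] P(2)
    using P(6) T(1) by simp
  have "P *\<^sub>v y \<in> gen_eigenspace_sum (spectrum A)"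
    if "m \<le> n" "y \<in> carrier_vec n" "\<And>j. m \<le> j \<Longrightarrow> j < n \<Longrightarrow> y $ j = 0" for m y
    using that
  proof (induction m arbitrary: y)
    case 0
    then have "y = 0\<^sub>v n" by (intro eq_vecI) auto
    then have "P *\<^sub>v y = vec n (\<lambda>j. \<Sum>\<mu>\<in>spectrum A. 0\<^sub>v n $ j)" using P by (intro eq_vecI) auto
    then show ?case
      unfolding gen_eigenspace_sum_def using zero_in_gen_eigenspace
      by (intro CollectI exI[of _ "\<lambda>_. 0\<^sub>v n"]) simp
  next
    case (Suc m)
    note y = Suc.prems(2)
    let ?a = "T $$ (m, m)"
    have "char_matrix T ?a *\<^sub>v y \<in> carrier_vec n"
      using char_matrix_closed[OF T(1)] y by (rule mult_mat_vec_carrier)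
    then have "P *\<^sub>v (char_matrix T ?a *\<^sub>v y) \<in> gen_eigenspace_sum (spectrum A)"
      using Suc upper_triangular_char_matrix_mult_eq_0[OF T(1,2) y, of m] by simp
    then have "char_matrix A ?a *\<^sub>v (P *\<^sub>v y) \<in> gen_eigenspace_sum (spectrum A)"
      unfolding char_matrix_similar_mult_vec[OF P(6) T(1) AP y] .
    moreover have "?a \<in> spectrum A"
      using Suc.prems(1) by (intro upper_triangular_similar_diag_in_spectrum[OF T]) simp
    ultimately show ?case
      using mult_mat_vec_carrier[OF P(6) y] gen_eigenspace_sum_if_char_matrix[OF finite_spectrum] by blast
  qed
  from this[of n "P' *\<^sub>v x"] show ?thesis
    using P assms assoc_mult_mat_vec[OF P(6,7) assms] by simp
qed

context
  fixes u :: "complex vec" and \<rho> :: complex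
  assumes u: "u \<in> carrier_vec n" and left: "transpose_mat A *\<^sub>v u = \<rho> \<cdot>\<^sub>v u"
begin

lemma left_eigenvector_char_matrix:
  assumes "x \<in> carrier_vec n"
  shows "u \<bullet> (char_matrix A \<mu> *\<^sub>v x) = (\<rho> - \<mu>) * (u \<bullet> x)"
proof -
  have "u \<bullet> (A *\<^sub>v x) = \<rho> * (u \<bullet> x)"
    using transpose_vec_mult_scalar[OF A assms u] left u assms by simp
  then show ?thesis
    using A u assms by (simp add: char_matrix_mult_vec scalar_prod_minus_distrib[of _ n] left_diff_distrib)
qed

lemma left_eigenvector_orthogonal:
  assumes "x \<in> gen_eigenspace A \<mu>" "\<mu> \<noteq> \<rho>"
  shows "u \<bullet> x = 0"
  using assms
proof (induction rule: gen_eigenspace_induct)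
  case zero
  then show ?case using u by simp
next
  case (step x)
  then show ?case using left_eigenvector_char_matrix[OF step.hyps(1), of \<mu>] by simp
qed

lemma simple_gen_eigenspace_eq_0:
  assumes simple: "\<And>x. x \<in> carrier_vec n \<Longrightarrow> A *\<^sub>v x = \<rho> \<cdot>\<^sub>v x \<Longrightarrow> u \<bullet> x = 0 \<Longrightarrow> x = 0\<^sub>v n"
    and "x \<in> gen_eigenspace A \<rho>" "u \<bullet> x = 0"
  shows "x = 0\<^sub>v n"
  using assms(2,3)
proof (induction rule: gen_eigenspace_induct)
  case (step x)
  have "char_matrix A \<rho> *\<^sub>v x = 0\<^sub>v n"
    using left_eigenvector_char_matrix[OF step.hyps(1), of \<rho>] by (intro step.IH) simp
  then have "A *\<^sub>v x - \<rho> \<cdot>\<^sub>v x = 0\<^sub>v n"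
    unfolding char_matrix_mult_vec[OF A step.hyps(1)] .
  then have "A *\<^sub>v x = \<rho> \<cdot>\<^sub>v x"
    using A step.hyps(1) by (auto simp: vec_eq_iff)
  then show ?case using simple step by blast
qed simp

proposition other_gen_eigenspaces_eq_annihilator:
  assumes simple: "\<And>x. x \<in> carrier_vec n \<Longrightarrow> A *\<^sub>v x = \<rho> \<cdot>\<^sub>v x \<Longrightarrow> u \<bullet> x = 0 \<Longrightarrow> x = 0\<^sub>v n"
  shows "other_gen_eigenspaces A \<rho> = {w \<in> carrier_vec n. u \<bullet> w = 0}"
proof (intro Set.set_eqI iffI)
  fix w assume "w \<in> other_gen_eigenspaces A \<rho>"
  then obtain f where f: "\<And>\<mu>. f \<mu> \<in> gen_eigenspace A \<mu>"
    and w: "w = vec n (\<lambda>j. \<Sum>\<mu>\<in>spectrum A - {\<rho>}. f \<mu> $ j)"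
    by (auto simp: other_gen_eigenspaces_eq_sum gen_eigenspace_sum_def)
  have "u \<bullet> w = (\<Sum>\<mu>\<in>spectrum A - {\<rho>}. u \<bullet> f \<mu>)"
    unfolding w using u gen_eigenspace_carrier[OF f] by (rule scalar_prod_sum_right)
  also have "\<dots> = 0" using left_eigenvector_orthogonal[OF f] by (intro sum.neutral) auto
  finally show "w \<in> {w \<in> carrier_vec n. u \<bullet> w = 0}" using w by simp
next
  fix w assume w: "w \<in> {w \<in> carrier_vec n. u \<bullet> w = 0}"
  then obtain f where f: "\<And>\<mu>. f \<mu> \<in> gen_eigenspace A \<mu>" and sum_f: "w = vec n (\<lambda>j. \<Sum>\<mu>\<in>spectrum A. f \<mu> $ j)"
    using gen_eigenspace_sum_spectrum[of w] by (auto simp: gen_eigenspace_sum_def)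
  have f_\<rho>: "f \<rho> = 0\<^sub>v n" if "\<rho> \<in> spectrum A"
  proof (rule simple_gen_eigenspace_eq_0[OF simple f])
    have "0 = (\<Sum>\<mu>\<in>spectrum A. u \<bullet> f \<mu>)"
      using w scalar_prod_sum_right[OF u, of "spectrum A" f] gen_eigenspace_carrier[OF f] sum_f by simp
    also have "\<dots> = u \<bullet> f \<rho> + (\<Sum>\<mu>\<in>spectrum A - {\<rho>}. u \<bullet> f \<mu>)"
      using that finite_spectrum by (rule sum.remove[rotated])
    also have "(\<Sum>\<mu>\<in>spectrum A - {\<rho>}. u \<bullet> f \<mu>) = 0"
      using left_eigenvector_orthogonal[OF f] by (intro sum.neutral) auto
    finally show "u \<bullet> f \<rho> = 0" by simp
  qed
  have "(\<Sum>\<mu>\<in>spectrum A. f \<mu> $ j) = (\<Sum>\<mu>\<in>spectrum A - {\<rho>}. f \<mu> $ j)" if "j < n" for j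
    using finite_spectrum f_\<rho> that by (intro sum.mono_neutral_right) auto
  then have "w = vec n (\<lambda>j. \<Sum>\<mu>\<in>spectrum A - {\<rho>}. f \<mu> $ j)"
    unfolding sum_f by (intro eq_vecI) auto
  then show "w \<in> other_gen_eigenspaces A \<rho>"
    unfolding other_gen_eigenspaces_eq_sum gen_eigenspace_sum_def using f by blast
qed

end

end

section \<open>Perron matrices\<close>

lemma index_pow_mat_eq_matpow:
  assumes A: "A \<in> carrier_mat n n" and "i < n" "j < n"
  shows "(A ^\<^sub>m m) $$ (i, j) = matpow {..<n} (\<lambda>i j. A $$ (i, j)) m i j"
  using assms(3)
proof (induction m arbitrary: j)
  case 0
  then show ?case using assms by simp
next
  case (Suc m)
  have "(A ^\<^sub>m Suc m) $$ (i, j) = (\<Sum>l<n. (A ^\<^sub>m m) $$ (i, l) * A $$ (l, j))"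
    using A pow_carrier_mat[OF A, of m] \<open>i < n\<close> Suc.prems by (simp add: scalar_prod_def lessThan_atLeast0)
  also have "\<dots> = matpow {..<n} (\<lambda>i j. A $$ (i, j)) (Suc m) i j"
    using Suc \<open>i < n\<close> by (subst matpow_Suc_right) auto
  finally show ?case .
qed

locale perron_matrix =
  fixes n :: nat and M :: "real mat" and \<rho> :: real and v :: "real vec"
  assumes n_pos: "n > 0" and M: "M \<in> carrier_mat n n"
    and M_nonneg: "\<And>a b. a < n \<Longrightarrow> b < n \<Longrightarrow> M $$ (a, b) \<ge> 0"
    and M_ev_pos: "eventually_positive M"
    and v: "v \<in> carrier_vec n" and v_pos: "\<And>a. a < n \<Longrightarrow> v $ a > 0"
    and v_eig: "M *\<^sub>v v = \<rho> \<cdot>\<^sub>v v"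
begin

definition is_left_perron :: "real vec \<Rightarrow> bool" where
  "is_left_perron u \<longleftrightarrow> u \<in> carrier_vec n \<and> transpose_mat M *\<^sub>v u = \<rho> \<cdot>\<^sub>v u \<and> u \<bullet> v = 1"

definition left_perron :: "real vec" where
  "left_perron = (THE u. is_left_perron u)"

abbreviation normalised :: "nat \<Rightarrow> nat \<Rightarrow> real" where
  "normalised a b \<equiv> M $$ (a, b) / \<rho>"

lemma v_eig_sum: "a < n \<Longrightarrow> (\<Sum>b<n. M $$ (a, b) * v $ b) = \<rho> * v $ a"
  using arg_cong[OF v_eig, of "\<lambda>x. x $ a"] index_mult_mat_vec_sum[OF M v, of a] v by simp

lemma positive_power:
  obtains m where "\<And>a b. a < n \<Longrightarrow> b < n \<Longrightarrow> (M ^\<^sub>m Suc m) $$ (a, b) > 0"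
  using M_ev_pos M unfolding eventually_positive_def by (metis carrier_matD le_SucI order_refl)

lemma rho_pos: "\<rho> > 0"
proof -
  obtain m where m: "(M ^\<^sub>m Suc m) $$ (0, 0) > 0" using positive_power n_pos by metis
  have "(M ^\<^sub>m Suc m) $$ (0, 0) = (\<Sum>b<n. M $$ (0, b) * matpow {..<n} (\<lambda>a b. M $$ (a, b)) m b 0)"
    unfolding index_pow_mat_eq_matpow[OF M n_pos n_pos] by simp
  with m obtain b where b: "b < n" "M $$ (0, b) \<noteq> 0"
    by (metis (no_types, lifting) lessThan_iff less_irrefl mult_zero_left sum.neutral)
  then have "0 < M $$ (0, b) * v $ b"
    using M_nonneg[OF n_pos b(1)] v_pos by (simp add: less_le)
  also have "\<dots> \<le> (\<Sum>b<n. M $$ (0, b) * v $ b)"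
    using b(1) n_pos M_nonneg v_pos by (intro member_le_sum mult_nonneg_nonneg) (auto intro: less_imp_le)
  also have "\<dots> = \<rho> * v $ 0" by (rule v_eig_sum[OF n_pos])
  finally show ?thesis using v_pos[OF n_pos] by (simp add: zero_less_mult_iff)
qed

lemma is_left_perron_iff:
  "is_left_perron w \<longleftrightarrow> w \<in> carrier_vec n \<and>
     (\<forall>b<n. (\<Sum>a<n. w $ a * normalised a b) = w $ b) \<and> (\<Sum>a<n. w $ a * v $ a) = 1"
proof (cases "w \<in> carrier_vec n")
  case True
  have "transpose_mat M *\<^sub>v w = \<rho> \<cdot>\<^sub>v w \<longleftrightarrow> (\<forall>b<n. (\<Sum>a<n. w $ a * M $$ (a, b)) = \<rho> * w $ b)"
    using M True by (auto simp: vec_eq_iff index_transpose_mult_vec_sum simp del: index_mult_mat_vec)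
  also have "\<dots> \<longleftrightarrow> (\<forall>b<n. (\<Sum>a<n. w $ a * normalised a b) = w $ b)"
    using rho_pos by (simp add: divide_eq_eq mult.commute flip: sum_divide_distrib)
  finally show ?thesis
    using True v by (auto simp: is_left_perron_def scalar_prod_def lessThan_atLeast0)
qed (simp add: is_left_perron_def)

lemma left_perron_exists:
  obtains w where "is_left_perron w" "\<And>b. b < n \<Longrightarrow> w $ b \<ge> 0"
    and "\<And>a b. a < n \<Longrightarrow> b < n \<Longrightarrow> (\<lambda>m. matpow {..<n} normalised m a b) \<longlonglongrightarrow> v $ a * w $ b"
proof -
  obtain m where m: "\<And>a b. a < n \<Longrightarrow> b < n \<Longrightarrow> (M ^\<^sub>m Suc m) $$ (a, b) > 0"
    using positive_power by blast
  have v_fixed: "(\<Sum>b<n. normalised a b * v $ b) = v $ a" if "a < n" for a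
    using that v_eig_sum[of a] rho_pos by (simp flip: sum_divide_distrib)
  obtain w where w_nonneg: "\<And>b. b \<in> {..<n} \<Longrightarrow> w b \<ge> 0"
    and lim: "\<And>a b. a \<in> {..<n} \<Longrightarrow> b \<in> {..<n} \<Longrightarrow> (\<lambda>m. matpow {..<n} normalised m a b) \<longlonglongrightarrow> v $ a * w b"
  proof (rule matpow_perron_limit[of "{..<n}" normalised "($) v" "Suc m"])
    show "matpow {..<n} normalised (Suc m) a b > 0" if "a \<in> {..<n}" "b \<in> {..<n}" for a b
      using that m[of a b] rho_pos
      by (simp add: matpow_divide index_pow_mat_eq_matpow[OF M] del: pow_mat.simps matpow.simps)
  qed (use M_nonneg v_pos v_fixed rho_pos in auto)
  have "v $ 0 = v $ 0 * (\<Sum>b<n. w b * v $ b)"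
    using lim n_pos v_fixed by (intro matpow_rank_one_limit_right_fixed[where A = normalised]) auto
  then have "(\<Sum>b<n. w b * v $ b) = 1" using v_pos[OF n_pos] by simp
  moreover have "(\<Sum>a<n. w a * normalised a b) = w b" if "b < n" for b
    using lim n_pos v_pos[OF n_pos] that
    by (intro matpow_rank_one_limit_is_left_fixed[where v = "($) v" and a = 0]) auto
  ultimately have "is_left_perron (vec n w)"
    by (simp add: is_left_perron_iff)
  with w_nonneg lim show ?thesis by (intro that[of "vec n w"]) simp_all
qed

lemma is_left_perron_unique:
  assumes "is_left_perron w" "is_left_perron w'"
  shows "w = w'"
proof -
  obtain x where lim: "\<And>a b. a < n \<Longrightarrow> b < n \<Longrightarrow> (\<lambda>m. matpow {..<n} normalised m a b) \<longlonglongrightarrow> v $ a * x $ b"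
    by (rule left_perron_exists) blast
  have "y $ b = x $ b" if "is_left_perron y" "b < n" for y b
    using that lim matpow_rank_one_limit_left_fixed[of "{..<n}" normalised "($) v" "($) x" "($) y" b]
    by (simp add: is_left_perron_iff)
  with assms show ?thesis
    by (intro eq_vecI) (auto simp: is_left_perron_def)
qed

lemma left_perron_eqI: "is_left_perron w \<Longrightarrow> left_perron = w"
  unfolding left_perron_def using is_left_perron_unique by (intro the_equality) auto

lemma is_left_perron_left_perron: "is_left_perron left_perron"
  and left_perron_nonneg: "\<And>b. b < n \<Longrightarrow> left_perron $ b \<ge> 0"
  and matpow_normalised_tendsto: "\<And>a b. a < n \<Longrightarrow> b < n \<Longrightarrow>
    (\<lambda>m. matpow {..<n} normalised m a b) \<longlonglongrightarrow> v $ a * left_perron $ b"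
proof -
  obtain w where w: "is_left_perron w" "\<And>b. b < n \<Longrightarrow> w $ b \<ge> 0"
    "\<And>a b. a < n \<Longrightarrow> b < n \<Longrightarrow> (\<lambda>m. matpow {..<n} normalised m a b) \<longlonglongrightarrow> v $ a * w $ b"
    by (rule left_perron_exists) blast
  have "left_perron = w" using w(1) by (rule left_perron_eqI)
  with w show "is_left_perron left_perron" "\<And>b. b < n \<Longrightarrow> left_perron $ b \<ge> 0"
    "\<And>a b. a < n \<Longrightarrow> b < n \<Longrightarrow> (\<lambda>m. matpow {..<n} normalised m a b) \<longlonglongrightarrow> v $ a * left_perron $ b"
    by simp_all
qed

lemma left_perron_carrier: "left_perron \<in> carrier_vec n"
  and left_perron_eig: "transpose_mat M *\<^sub>v left_perron = \<rho> \<cdot>\<^sub>v left_perron"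
  and left_perron_scalar_prod: "left_perron \<bullet> v = 1"
  using is_left_perron_left_perron by (simp_all add: is_left_perron_def)

lemma right_eigenvector_eq:
  assumes x: "x \<in> carrier_vec n" "M *\<^sub>v x = \<rho> \<cdot>\<^sub>v x"
  shows "x = (left_perron \<bullet> x) \<cdot>\<^sub>v v"
proof (rule eq_vecI)
  fix a assume "a < dim_vec ((left_perron \<bullet> x) \<cdot>\<^sub>v v)"
  then have a: "a < n" using v by simp
  have "x $ a = v $ a * (\<Sum>b<n. left_perron $ b * x $ b)"
  proof (rule matpow_rank_one_limit_right_fixed[where A = normalised and S = "{..<n}"])
    show "(\<Sum>b<n. normalised a b * x $ b) = x $ a" if "a \<in> {..<n}" for a
      using that arg_cong[OF x(2), of "\<lambda>x. x $ a"] index_mult_mat_vec_sum[OF M x(1), of a] x(1) rho_pos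
      by (simp flip: sum_divide_distrib)
  qed (use a matpow_normalised_tendsto in auto)
  then show "x $ a = ((left_perron \<bullet> x) \<cdot>\<^sub>v v) $ a"
    using a x v by (simp add: scalar_prod_def lessThan_atLeast0)
qed (use v x in simp)

lemma normalised_right_eigenvector_eq:
  assumes x: "x \<in> carrier_vec n" "M *\<^sub>v x = \<rho> \<cdot>\<^sub>v x" and "(\<Sum>a<n. x $ a) = (\<Sum>a<n. v $ a)"
  shows "x = v"
proof -
  define c where "c = left_perron \<bullet> x"
  have x_eq: "x = c \<cdot>\<^sub>v v" unfolding c_def using x by (rule right_eigenvector_eq)
  have "(\<Sum>a<n. x $ a) = c * (\<Sum>a<n. v $ a)"
    using v by (simp add: x_eq sum_distrib_left)
  moreover have "(\<Sum>a<n. v $ a) > 0" using n_pos v_pos by (intro sum_pos) auto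
  ultimately show ?thesis using assms(3) x_eq by simp
qed

lemma cmat_carrier: "cmat M \<in> carrier_mat n n"
  and cvec_carrier: "x \<in> carrier_vec n \<Longrightarrow> cvec x \<in> carrier_vec n"
  using M by (simp_all add: cmat_def cvec_def)

lemma cvec_scalar_prod:
  "x \<in> carrier_vec n \<Longrightarrow> y \<in> carrier_vec n \<Longrightarrow> cvec x \<bullet> cvec y = of_real (x \<bullet> y)"
  by (simp add: cvec_def scalar_prod_def)

lemma complex_eigenvector_eq_0:
  assumes x: "x \<in> carrier_vec n" "cmat M *\<^sub>v x = of_real \<rho> \<cdot>\<^sub>v x" and "cvec left_perron \<bullet> x = 0"
  shows "x = 0\<^sub>v n"
proof -
  have part: "map_vec F x = 0\<^sub>v n"
    if F_sum: "\<And>f :: nat \<Rightarrow> complex. F (\<Sum>b<n. f b) = (\<Sum>b<n. F (f b))"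
      and F_scale: "\<And>c z. F (of_real c * z) = c * F z" for F :: "complex \<Rightarrow> real"
  proof -
    have "M *\<^sub>v map_vec F x = \<rho> \<cdot>\<^sub>v map_vec F x"
    proof (rule eq_vecI)
      fix a assume "a < dim_vec (\<rho> \<cdot>\<^sub>v map_vec F x)"
      then have a: "a < n" using x by simp
      have "(\<Sum>b<n. of_real (M $$ (a, b)) * x $ b) = of_real \<rho> * x $ a"
        using arg_cong[OF x(2), of "\<lambda>x. x $ a"] index_mult_mat_vec_sum[OF cmat_carrier x(1) a] a x(1) M
        by (simp add: cmat_def)
      from arg_cong[OF this, of F] show "(M *\<^sub>v map_vec F x) $ a = (\<rho> \<cdot>\<^sub>v map_vec F x) $ a"
        using a x(1) index_mult_mat_vec_sum[OF M, of "map_vec F x" a] by (simp add: F_sum F_scale)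
    qed (use M x in simp)
    then have eq: "map_vec F x = (left_perron \<bullet> map_vec F x) \<cdot>\<^sub>v v"
      using x by (intro right_eigenvector_eq) auto
    have "(\<Sum>b<n. of_real (left_perron $ b) * x $ b) = 0"
      using assms(3) x(1) left_perron_carrier by (simp add: cvec_def scalar_prod_def lessThan_atLeast0)
    from arg_cong[OF this, of F] have "(\<Sum>b<n. left_perron $ b * F (x $ b)) = 0"
      using F_scale[of 0 0] by (simp add: F_sum F_scale)
    then have "left_perron \<bullet> map_vec F x = 0"
      using x(1) by (simp add: scalar_prod_def lessThan_atLeast0)
    with eq show ?thesis using v by (auto simp: vec_eq_iff)
  qed
  have "Re (x $ a) = 0" "Im (x $ a) = 0" if "a < n" for a
    using part[of Re] part[of Im] that x(1) by (auto simp: vec_eq_iff)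
  then show ?thesis using x(1) by (intro eq_vecI) (auto simp: complex_eq_iff)
qed

lemma other_gen_eigenspaces_eq:
  "other_gen_eigenspaces (cmat M) (of_real \<rho>) = {w \<in> carrier_vec n. cvec left_perron \<bullet> w = 0}"
proof (rule other_gen_eigenspaces_eq_annihilator[OF cmat_carrier cvec_carrier[OF left_perron_carrier]])
  have "transpose_mat (cmat M) *\<^sub>v cvec left_perron = cvec (transpose_mat M *\<^sub>v left_perron)"
    using M left_perron_carrier
    by (intro eq_vecI) (auto simp: cmat_def cvec_def scalar_prod_def)
  also have "\<dots> = of_real \<rho> \<cdot>\<^sub>v cvec left_perron"
    unfolding left_perron_eig by (intro eq_vecI) (simp_all add: cvec_def)
  finally show "transpose_mat (cmat M) *\<^sub>v cvec left_perron = of_real \<rho> \<cdot>\<^sub>v cvec left_perron" .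
qed (fact complex_eigenvector_eq_0)

proposition eigenvector_coefficient:
  assumes x: "x \<in> carrier_vec n"
  shows "(THE c. \<exists>w\<in>other_gen_eigenspaces (cmat M) (of_real \<rho>). cvec x = complex_of_real c \<cdot>\<^sub>v cvec v + w)
    = left_perron \<bullet> x"
proof -
  have "(\<exists>w\<in>other_gen_eigenspaces (cmat M) (of_real \<rho>). cvec x = of_real c \<cdot>\<^sub>v cvec v + w)
      \<longleftrightarrow> left_perron \<bullet> x = c" for c
  proof -
    have decomposition: "cvec x = of_real c \<cdot>\<^sub>v cvec v + w \<longleftrightarrow> w = cvec x - of_real c \<cdot>\<^sub>v cvec v"
      if "w \<in> carrier_vec n" for w
      using that cvec_carrier[OF x] cvec_carrier[OF v] by (auto simp: vec_eq_iff algebra_simps)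
    have "cvec left_perron \<bullet> (cvec x - of_real c \<cdot>\<^sub>v cvec v) = of_real (left_perron \<bullet> x) - of_real c"
      using cvec_carrier[OF left_perron_carrier] cvec_carrier[OF x] cvec_carrier[OF v]
        cvec_scalar_prod[OF left_perron_carrier x] cvec_scalar_prod[OF left_perron_carrier v] left_perron_scalar_prod
      by (simp add: scalar_prod_minus_distrib[of _ n])
    moreover have "cvec x - of_real c \<cdot>\<^sub>v cvec v \<in> carrier_vec n"
      using cvec_carrier[OF x] cvec_carrier[OF v] by simp
    ultimately show ?thesis
      unfolding other_gen_eigenspaces_eq using decomposition by (auto simp flip: of_real_diff)
  qed
  then show ?thesis by simp
qed

end

section \<open>Occupation times of the absorbed chain\<close>

definition alive_lists :: "nat \<Rightarrow> nat \<Rightarrow> nat list set" where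
  "alive_lists d n = {ys. length ys = n \<and> set ys \<subseteq> {1..d}}"

definition walk_weight :: "real mat \<Rightarrow> real vec \<Rightarrow> nat list \<Rightarrow> real" where
  "walk_weight Q R xs = (\<Prod>i<length xs - 1. trans Q R (xs ! i) (xs ! Suc i))"

abbreviation (input) entry :: "real mat \<Rightarrow> nat \<Rightarrow> nat \<Rightarrow> real" where
  "entry Q \<equiv> \<lambda>a b. Q $$ (a, b)"

lemma alive_lists_0: "alive_lists d 0 = {[]}"
  by (auto simp: alive_lists_def)

lemma walk_weight_Cons_Cons:
  "walk_weight Q R (x # y # ys) = trans Q R x y * walk_weight Q R (y # ys)"
  unfolding walk_weight_def by (simp add: prod.lessThan_Suc_shift del: prod.lessThan_Suc)

lemma sum_alive_lists_Suc:
  "(\<Sum>ys\<in>alive_lists d (Suc n). g ys) = (\<Sum>b<d. \<Sum>ys\<in>alive_lists d n. g (Suc b # ys))"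
proof -
  have "(\<Sum>b<d. \<Sum>ys\<in>alive_lists d n. g (Suc b # ys))
      = (\<Sum>(b, ys)\<in>{..<d} \<times> alive_lists d n. g (Suc b # ys))"
    by (simp add: sum.cartesian_product)
  also have "\<dots> = (\<Sum>ys\<in>alive_lists d (Suc n). g ys)"
    by (rule sum.reindex_bij_witness[of _ "\<lambda>ys. (hd ys - 1, tl ys)" "\<lambda>(b, ys). Suc b # ys"])
       (auto simp: alive_lists_def length_Suc_conv)
  finally show ?thesis by simp
qed

lemma sum_alive_lists_Suc_walk_weight:
  "(\<Sum>ys\<in>alive_lists d (Suc n). walk_weight Q R (Suc a # ys) * g ys)
    = (\<Sum>b<d. Q $$ (a, b) * (\<Sum>ys\<in>alive_lists d n. walk_weight Q R (Suc b # ys) * g (Suc b # ys)))"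
  by (simp add: sum_alive_lists_Suc walk_weight_Cons_Cons trans_def sum_distrib_left mult.assoc)

lemma sum_walk_weight:
  assumes "a < d"
  shows "(\<Sum>ys\<in>alive_lists d n. walk_weight Q R (Suc a # ys)) = (\<Sum>b<d. matpow {..<d} (entry Q) n a b)"
  using assms
proof (induction n arbitrary: a)
  case 0
  then show ?case by (simp add: alive_lists_0 walk_weight_def of_bool_def)
next
  case (Suc n)
  have "(\<Sum>ys\<in>alive_lists d (Suc n). walk_weight Q R (Suc a # ys))
      = (\<Sum>c<d. Q $$ (a, c) * (\<Sum>b<d. matpow {..<d} (entry Q) n c b))"
    using sum_alive_lists_Suc_walk_weight[where g = "\<lambda>_. 1"] Suc.IH by simp
  also have "\<dots> = (\<Sum>b<d. \<Sum>c<d. Q $$ (a, c) * matpow {..<d} (entry Q) n c b)"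
    unfolding sum_distrib_left by (rule sum.swap)
  finally show ?case by simp
qed

lemma sum_walk_weight_visits:
  assumes "a < d" "s < d"
  shows "(\<Sum>ys\<in>alive_lists d n. walk_weight Q R (Suc a # ys) * real (count_list (Suc a # ys) (Suc s)))
    = (\<Sum>m\<le>n. matpow {..<d} (entry Q) m a s * (\<Sum>b<d. matpow {..<d} (entry Q) (n - m) s b))"
  using assms(1)
proof (induction n arbitrary: a)
  case 0
  then show ?case using assms(2) by (simp add: alive_lists_0 walk_weight_def of_bool_def)
next
  case (Suc n)
  let ?w = "\<lambda>ys. walk_weight Q R (Suc a # ys)" and ?N = "\<lambda>xs. real (count_list xs (Suc s))"
  let ?S = "\<lambda>m. \<Sum>b<d. matpow {..<d} (entry Q) m s b"
  have later: "(\<Sum>ys\<in>alive_lists d (Suc n). ?w ys * ?N ys)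
      = (\<Sum>m\<le>n. matpow {..<d} (entry Q) (Suc m) a s * ?S (n - m))"
  proof -
    have "(\<Sum>ys\<in>alive_lists d (Suc n). ?w ys * ?N ys)
        = (\<Sum>c<d. Q $$ (a, c) * (\<Sum>m\<le>n. matpow {..<d} (entry Q) m c s * ?S (n - m)))"
      unfolding sum_alive_lists_Suc_walk_weight using Suc.IH by simp
    also have "\<dots> = (\<Sum>m\<le>n. \<Sum>c<d. Q $$ (a, c) * (matpow {..<d} (entry Q) m c s * ?S (n - m)))"
      unfolding sum_distrib_left[of "Q $$ _"] by (rule sum.swap)
    finally show ?thesis by (simp add: sum_distrib_right mult.assoc)
  qed
  have now: "(\<Sum>ys\<in>alive_lists d (Suc n). ?w ys * of_bool (a = s)) = of_bool (a = s) * ?S (Suc n)"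
    using sum_walk_weight[OF Suc.prems] by (cases "a = s") simp_all
  have "(\<Sum>ys\<in>alive_lists d (Suc n). ?w ys * ?N (Suc a # ys))
      = (\<Sum>ys\<in>alive_lists d (Suc n). ?w ys * ?N ys + ?w ys * of_bool (a = s))"
    by (intro sum.cong) (auto simp: algebra_simps)
  then show ?case
    unfolding sum.distrib later now sum.atMost_Suc_shift by simp
qed

lemma sum_surviving_traj:
  fixes g :: "nat list \<Rightarrow> real"
  shows "(\<Sum>xs\<in>traj d n. if 0 \<notin> set xs then g xs else 0) = (\<Sum>a<d. \<Sum>ys\<in>alive_lists d n. g (Suc a # ys))"
proof -
  have "finite (traj d n)"
    unfolding traj_def using finite_lists_length_eq[of "{0..d}" "Suc n"] by (simp add: conj_commute)
  moreover have "{xs \<in> traj d n. 0 \<notin> set xs} = alive_lists d (Suc n)"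
    by (auto simp: traj_def alive_lists_def subset_iff Suc_le_eq intro: gr0I)
  ultimately show ?thesis
    by (simp add: sum.inter_filter[symmetric] sum_alive_lists_Suc)
qed

lemma path_prob_Cons: "path_prob Q R \<pi> (Suc a # ys) = \<pi> $ a * walk_weight Q R (Suc a # ys)"
  by (simp add: path_prob_def init_dist_def walk_weight_def)

lemma sum_traj_survival:
  "(\<Sum>xs\<in>traj d n. if 0 \<notin> set xs then path_prob Q R \<pi> xs else 0)
    = fps_nth (resolvent_form {..<d} (entry Q) (($) \<pi>) (\<lambda>_. 1)) n"
  unfolding sum_surviving_traj path_prob_Cons fps_nth_resolvent_form
  by (simp add: sum_walk_weight flip: sum_distrib_left)

lemma sum_traj_occupation:
  assumes s: "s < d"
  shows "(\<Sum>xs\<in>traj d n. if 0 \<notin> set xs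
      then path_prob Q R \<pi> xs * (real (card {m. m \<le> n \<and> xs ! m = Suc s}) / real (Suc n)) else 0)
    = fps_nth (resolvent_form {..<d} (entry Q) (($) \<pi>) (\<lambda>b. of_bool (b = s)) *
        resolvent_form {..<d} (entry Q) (\<lambda>a. of_bool (a = s)) (\<lambda>_. 1)) n / real (Suc n)"
    (is "?lhs = fps_nth (?F * ?G) n / _")
proof -
  let ?P = "matpow {..<d} (entry Q)"
  have visits: "card {m. m \<le> n \<and> (Suc a # ys) ! m = Suc s} = count_list (Suc a # ys) (Suc s)"
    if "ys \<in> alive_lists d n" for a ys
    unfolding count_list_eq_length_filter length_filter_conv_card
    using that by (intro arg_cong[where f = card]) (auto simp: alive_lists_def less_Suc_eq_le)
  have "?lhs = (\<Sum>a<d. \<pi> $ a *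
      (\<Sum>ys\<in>alive_lists d n. walk_weight Q R (Suc a # ys) * real (count_list (Suc a # ys) (Suc s)))) / real (Suc n)"
    unfolding sum_surviving_traj path_prob_Cons sum_divide_distrib sum_distrib_left
    by (intro sum.cong refl) (simp only: visits times_divide_eq_right mult.assoc)
  also have "\<dots> = (\<Sum>a<d. \<pi> $ a * (\<Sum>m\<le>n. ?P m a s * (\<Sum>b<d. ?P (n - m) s b))) / real (Suc n)"
    using sum_walk_weight_visits[OF _ s] by simp
  also have "(\<Sum>a<d. \<pi> $ a * (\<Sum>m\<le>n. ?P m a s * (\<Sum>b<d. ?P (n - m) s b)))
      = (\<Sum>m\<le>n. (\<Sum>a<d. \<pi> $ a * ?P m a s) * (\<Sum>b<d. ?P (n - m) s b))"
    unfolding sum_distrib_left[of "\<pi> $ _"] by (subst sum.swap) (simp add: sum_distrib_right mult.assoc)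
  also have "\<dots> = fps_nth (?F * ?G) n"
    using s by (simp add: fps_mult_nth fps_nth_resolvent_form_indicator_left
        fps_nth_resolvent_form_indicator_right atLeast0AtMost)
  finally show ?thesis .
qed

lemma fps_nth_mult_divide:
  fixes F G F' G' :: "real fps"
  assumes "\<And>n. fps_nth F' n = fps_nth F n / r ^ n" "\<And>n. fps_nth G' n = fps_nth G n / r ^ n"
  shows "fps_nth (F' * G') n = fps_nth (F * G) n / r ^ n"
proof -
  have "r ^ n = r ^ m * r ^ (n - m)" if "m \<in> {0..n}" for m
    using that by (simp flip: power_add)
  then show ?thesis
    by (simp add: fps_mult_nth assms sum_divide_distrib)
qed

lemma cond_occupation_eq_resolvent_forms:
  fixes Q :: "real mat" and \<pi> :: "real vec"
  assumes "s < d" "r \<noteq> 0"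
  defines "A \<equiv> \<lambda>a b. Q $$ (a, b) / r"
  shows "cond_occupation Q R \<pi> d n (Suc s) =
    fps_nth (resolvent_form {..<d} A (($) \<pi>) (\<lambda>b. of_bool (b = s)) *
      resolvent_form {..<d} A (\<lambda>a. of_bool (a = s)) (\<lambda>_. 1)) n / real (Suc n) /
    fps_nth (resolvent_form {..<d} A (($) \<pi>) (\<lambda>_. 1)) n"
  using \<open>r \<noteq> 0\<close> unfolding cond_occupation_def sum_traj_occupation[OF \<open>s < d\<close>] sum_traj_survival A_def
  by (simp add: fps_nth_mult_divide[OF fps_nth_resolvent_form_divide fps_nth_resolvent_form_divide]
      fps_nth_resolvent_form_divide)

section \<open>The Frobenius normal form\<close>

definition block :: "(nat \<Rightarrow> nat) \<Rightarrow> nat \<Rightarrow> nat set" where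
  "block ds i = (+) (off ds i) ` {..<ds i}"

definition blockwise :: "(nat \<Rightarrow> nat) \<Rightarrow> (nat \<Rightarrow> 'a vec) \<Rightarrow> nat \<Rightarrow> nat \<Rightarrow> 'a" where
  "blockwise ds x i a = x i $ (a - off ds i)"

lemma blockwise_off_add [simp]: "blockwise ds x i (off ds i + a) = x i $ a"
  by (simp add: blockwise_def)

lemma block_eq_interval: "block ds i = {off ds i..<off ds i + ds i}"
  by (simp add: block_def lessThan_atLeast0 add.commute)

lemma sum_block: "(\<Sum>b\<in>block ds i. g b) = (\<Sum>b<ds i. g (off ds i + b))"
  unfolding block_def by (simp add: sum.reindex)

lemma off_Suc: "1 \<le> i \<Longrightarrow> off ds (Suc i) = off ds i + ds i"
  by (simp add: off_def)

lemma off_add_le: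
  assumes "1 \<le> i" "i < j"
  shows "off ds i + ds i \<le> off ds j"
proof -
  have "off ds (Suc i) \<le> off ds j"
    unfolding off_def using assms by (intro sum_mono2) auto
  then show ?thesis using assms by (simp add: off_Suc)
qed

lemma block_disjoint: "1 \<le> i \<Longrightarrow> 1 \<le> j \<Longrightarrow> i \<noteq> j \<Longrightarrow> block ds i \<inter> block ds j = {}"
proof (induction i j rule: linorder_wlog)
  case (le i j)
  then show ?case using off_add_le[of i j ds] by (auto simp: block_eq_interval)
qed auto

lemma UN_block: "(\<Union>j\<in>{1..k}. block ds j) = {..<off ds (Suc k)}"
proof (induction k)
  case 0
  then show ?case by (simp add: off_def)
next
  case (Suc k)
  have "(\<Union>j\<in>{1..Suc k}. block ds j) = block ds (Suc k) \<union> {..<off ds (Suc k)}"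
    using Suc by (simp add: atLeastAtMostSuc_conv)
  also have "\<dots> = {..<off ds (Suc (Suc k))}"
    unfolding off_Suc[of "Suc k", simplified] block_eq_interval by auto
  finally show ?case .
qed

lemma blk_carrier: "blk Q ds i j \<in> carrier_mat (ds i) (ds j)"
  by (simp add: blk_def)

lemma matpow_block:
  assumes "a < ds i" "b < ds i"
  shows "matpow (block ds i) (entry Q) n (off ds i + a) (off ds i + b)
    = matpow {..<ds i} (entry (blk Q ds i i)) n a b"
  using assms by (intro matpow_reindex) (auto simp: block_def bij_betw_def blk_def)

locale frobenius_form =
  fixes d k :: nat and Q :: "real mat" and ds :: "nat \<Rightarrow> nat" and v :: "nat \<Rightarrow> real vec"
  assumes Q_nonneg: "\<And>i j. i < d \<Longrightarrow> j < d \<Longrightarrow> Q $$ (i, j) \<ge> 0"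
    and k_pos: "k \<ge> 1" and ds_pos: "\<And>i. i \<in> {1..k} \<Longrightarrow> ds i \<ge> 1" and ds_sum: "(\<Sum>i\<in>{1..k}. ds i) = d"
    and lower: "\<And>i j. i \<in> {1..k} \<Longrightarrow> j \<in> {1..k} \<Longrightarrow> i < j \<Longrightarrow> blk Q ds i j = 0\<^sub>m (ds i) (ds j)"
    and evpos: "\<And>i. i \<in> {1..k} \<Longrightarrow> eventually_positive (blk Q ds i i)"
    and v_carrier: "\<And>i. i \<in> {1..k} \<Longrightarrow> v i \<in> carrier_vec (ds i)"
    and v_pos: "\<And>i a. i \<in> {1..k} \<Longrightarrow> a < ds i \<Longrightarrow> v i $ a > 0"
    and v_eig: "\<And>i. i \<in> {1..k} \<Longrightarrow> blk Q ds i i *\<^sub>v v i = PF_eig Q ds i \<cdot>\<^sub>v v i"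
    and v_sum: "\<And>i. i \<in> {1..k} \<Longrightarrow> (\<Sum>a<ds i. v i $ a) = 1"
    and scalar: "\<And>i. i \<in> {1..k} \<Longrightarrow> PF_eig Q ds i < rho_max Q ds k \<Longrightarrow> ds i = 1"
begin

abbreviation \<rho> :: "nat \<Rightarrow> real" where "\<rho> i \<equiv> PF_eig Q ds i"

abbreviation \<rho>m :: real where "\<rho>m \<equiv> rho_max Q ds k"

abbreviation scaled :: "nat \<Rightarrow> nat \<Rightarrow> real" where "scaled a b \<equiv> Q $$ (a, b) / \<rho>m"

definition u :: "nat \<Rightarrow> real vec" where
  "u i = perron_matrix.left_perron (ds i) (blk Q ds i i) (\<rho> i) (v i)"

definition pole_ord :: "nat \<Rightarrow> nat" where
  "pole_ord i = of_bool (\<rho> i = \<rho>m)"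

definition block_mass :: "nat \<Rightarrow> real" where
  "block_mass i = (if \<rho> i = \<rho>m then 1 else \<rho>m / (\<rho>m - \<rho> i))"

lemma UN_block_eq: "(\<Union>j\<in>{1..k}. block ds j) = {..<d}"
  unfolding UN_block using ds_sum by (simp add: off_def atLeastLessThanSuc_atLeastAtMost)

lemma block_less: "i \<in> {1..k} \<Longrightarrow> a \<in> block ds i \<Longrightarrow> a < d"
  using UN_block_eq by blast

lemma off_add_less: "i \<in> {1..k} \<Longrightarrow> a < ds i \<Longrightarrow> off ds i + a < d"
  by (rule block_less) (auto simp: block_def)

lemma perron_block: "i \<in> {1..k} \<Longrightarrow> perron_matrix (ds i) (blk Q ds i i) (\<rho> i) (v i)"
  using ds_pos evpos v_carrier v_pos v_eig Q_nonneg off_add_less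
  by unfold_locales (auto simp: blk_def Suc_le_eq)

lemmas rho_pos = perron_matrix.rho_pos[OF perron_block]
  and u_carrier = perron_matrix.left_perron_carrier[OF perron_block, folded u_def]
  and u_scalar_prod_v = perron_matrix.left_perron_scalar_prod[OF perron_block, folded u_def]
  and u_nonneg = perron_matrix.left_perron_nonneg[OF perron_block, folded u_def]
  and block_power_tendsto = perron_matrix.matpow_normalised_tendsto[OF perron_block, folded u_def]

lemma rho_le_max: "i \<in> {1..k} \<Longrightarrow> \<rho> i \<le> \<rho>m"
  unfolding rho_max_def by (intro Max_ge) auto

lemma rho_max_pos: "\<rho>m > 0"
  using rho_le_max[of 1] rho_pos[of 1] k_pos by auto

lemma coef_eq: "i \<in> {1..k} \<Longrightarrow> x \<in> carrier_vec (ds i) \<Longrightarrow> coef Q ds v i x = u i \<bullet> x"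
  unfolding coef_def Vminus_def u_def by (rule perron_matrix.eigenvector_coefficient[OF perron_block])

lemma scalar_block:
  assumes i: "i \<in> {1..k}" and "\<rho> i < \<rho>m"
  shows "ds i = 1" "v i $ 0 = 1" "u i $ 0 = 1" "blk Q ds i i $$ (0, 0) = \<rho> i"
proof -
  show ds: "ds i = 1" using assms by (rule scalar)
  show v: "v i $ 0 = 1" using v_sum[OF i] ds by simp
  show "u i $ 0 = 1" using u_scalar_prod_v[OF i] v_carrier[OF i] ds v by (simp add: scalar_prod_def)
  show "blk Q ds i i $$ (0, 0) = \<rho> i"
    using perron_matrix.v_eig_sum[OF perron_block[OF i], of 0] ds v by simp
qed

lemma block_growth:
  assumes i: "i \<in> {1..k}" and "a \<in> block ds i" "b \<in> block ds i"
  shows "pole_growth (pole_ord i) (blockwise ds v i a * block_mass i * blockwise ds u i b)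
    (resolvent (block ds i) scaled a b)"
proof -
  obtain a' b' where a': "a' < ds i" "a = off ds i + a'" and b': "b' < ds i" "b = off ds i + b'"
    using assms(2,3) by (auto simp: block_def)
  show ?thesis
  proof (cases "\<rho> i = \<rho>m")
    case True
    then show ?thesis
      using block_power_tendsto[OF i a'(1) b'(1)] a' b'
      by (simp add: pole_ord_def block_mass_def pole_growth_Suc[of 0, simplified] multichoose_def
          matpow_block matpow_divide)
  next
    case False
    then have "\<rho> i < \<rho>m" using rho_le_max[OF i] by simp
    note block = scalar_block[OF i this]
    have "matpow (block ds i) scaled n a b = (\<rho> i / \<rho>m) ^ n" for n
    proof -
      have "matpow {..<ds i} (entry (blk Q ds i i)) n 0 0 = \<rho> i ^ n"
        by (induction n) (simp_all add: block lessThan_Suc)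
      then show ?thesis using matpow_block[of a' ds i b' Q n] a' b' block(1) by (simp add: matpow_divide power_divide)
    qed
    then have "resolvent (block ds i) scaled a b = Abs_fps (\<lambda>n. (\<rho> i / \<rho>m) ^ n)"
      by (simp add: fps_eq_iff)
    moreover have "1 / (1 - \<rho> i / \<rho>m) = block_mass i"
      using rho_max_pos False by (simp add: block_mass_def field_simps)
    moreover have "\<bar>\<rho> i / \<rho>m\<bar> < 1" using \<open>\<rho> i < \<rho>m\<close> rho_pos[OF i] by simp
    ultimately show ?thesis
      using pole_growth_geometric[of "\<rho> i / \<rho>m"] False a' b' block by (simp add: pole_ord_def blockwise_def)
  qed
qed

sublocale pbt: perron_block_triangular scaled "block ds" k "blockwise ds v" "blockwise ds u" pole_ord block_mass
proof
  show "finite (block ds i)" for i by (simp add: block_def)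
  show "block ds i \<inter> block ds j = {}" if "i \<in> {1..k}" "j \<in> {1..k}" "i \<noteq> j" for i j
    using that by (simp add: block_disjoint)
next
  fix i j a b
  assume ij: "i \<in> {1..k}" "j \<in> {1..k}" "i < j" and "a \<in> block ds i" "b \<in> block ds j"
  then obtain a' b' where "a' < ds i" "b' < ds j" "a = off ds i + a'" "b = off ds j + b'"
    by (auto simp: block_def)
  moreover from this have "blk Q ds i j $$ (a', b') = 0" using lower[OF ij] by simp
  ultimately show "scaled a b = 0" by (simp add: blk_def)
qed (fact block_growth)

lemma linked_iff: "pbt.linked i j \<longleftrightarrow> blk Q ds i j \<noteq> 0\<^sub>m (ds i) (ds j)"
  using rho_max_pos by (auto simp: pbt.linked_def block_def mat_eq_iff blk_def)

lemma paths_eq: "pbt.paths = adm_paths Q ds k"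
  unfolding pbt.paths_def adm_paths_def admissible_def successively_conv_nth linked_iff ..

lemma adm_paths_nonempty: "\<theta> \<in> adm_paths Q ds k \<Longrightarrow> \<theta> \<noteq> []"
  and adm_paths_subset: "\<theta> \<in> adm_paths Q ds k \<Longrightarrow> set \<theta> \<subseteq> {1..k}"
  by (auto simp: adm_paths_def admissible_def)

lemma path_ord_eq_card_Hplus:
  assumes "rho_path Q ds \<theta> = \<rho>m"
  shows "pbt.path_ord \<theta> = card (Hplus Q ds \<theta>)"
proof -
  have "pbt.path_ord \<theta> = length (filter (\<lambda>i. \<rho> i = \<rho>m) \<theta>)"
    unfolding pbt.path_ord_def by (induction \<theta>) (auto simp: pole_ord_def)
  then show ?thesis using assms by (simp add: Hplus_def length_filter_conv_card)
qed

lemma rho_path_eq_max_iff: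
  assumes "\<theta> \<in> adm_paths Q ds k"
  shows "rho_path Q ds \<theta> = \<rho>m \<longleftrightarrow> pbt.path_ord \<theta> \<noteq> 0"
proof -
  have ne: "set \<theta> \<noteq> {}" and in_range: "set \<theta> \<subseteq> {1..k}"
    using adm_paths_nonempty[OF assms] adm_paths_subset[OF assms] by auto
  have "\<forall>x\<in>\<rho> ` set \<theta>. x \<le> \<rho>m" using in_range rho_le_max by auto
  then have "rho_path Q ds \<theta> = \<rho>m \<longleftrightarrow> \<rho>m \<in> \<rho> ` set \<theta>"
    unfolding rho_path_def using ne by (subst Max_eq_iff) auto
  also have "\<dots> \<longleftrightarrow> (\<exists>i\<in>set \<theta>. \<rho> i = \<rho>m)" by (metis image_iff)
  also have "\<dots> \<longleftrightarrow> pbt.path_ord \<theta> \<noteq> 0"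
    by (simp add: pbt.path_ord_def pole_ord_def sum_list_eq_0_iff)
  finally show ?thesis .
qed

lemma
  assumes "Pmax Q ds k \<noteq> {}"
  shows hplus_max_pos: "hplus_max Q ds k \<noteq> 0"
    and path_ord_le: "\<And>\<theta>. \<theta> \<in> pbt.paths \<Longrightarrow> pbt.path_ord \<theta> \<le> hplus_max Q ds k"
    and Pmax_eq: "Pmax Q ds k = {\<theta> \<in> pbt.paths. pbt.path_ord \<theta> = hplus_max Q ds k}"
proof -
  show pos: "hplus_max Q ds k \<noteq> 0"
    using assms rho_path_eq_max_iff path_ord_eq_card_Hplus by (fastforce simp: Pmax_def)
  show "pbt.path_ord \<theta> \<le> hplus_max Q ds k" if \<theta>: "\<theta> \<in> pbt.paths" for \<theta>
  proof (cases "rho_path Q ds \<theta> = \<rho>m")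
    case True
    have "card (Hplus Q ds \<theta>) \<le> hplus_max Q ds k"
      unfolding hplus_max_def using True \<theta> pbt.finite_paths by (intro Max_ge) (auto simp: paths_eq)
    then show ?thesis using path_ord_eq_card_Hplus[OF True] by simp
  next
    case False
    then show ?thesis using rho_path_eq_max_iff \<theta> by (simp add: paths_eq)
  qed
  have "card (Hplus Q ds \<theta>) = hplus_max Q ds k \<and> rho_path Q ds \<theta> = \<rho>m
      \<longleftrightarrow> pbt.path_ord \<theta> = hplus_max Q ds k" if "\<theta> \<in> adm_paths Q ds k" for \<theta>
    using rho_path_eq_max_iff[OF that] path_ord_eq_card_Hplus[of \<theta>] pos by metis
  then show "Pmax Q ds k = {\<theta> \<in> pbt.paths. pbt.path_ord \<theta> = hplus_max Q ds k}"
    unfolding Pmax_def paths_eq by blast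
qed

lemma piv_eq: "piv ds \<pi> v i = (\<Sum>a\<in>block ds i. \<pi> $ a * blockwise ds v i a)"
  by (simp add: piv_def sum_block)

lemma alpha_path_Cons:
  "alpha_path Q ds v (i # j # \<theta>) = coef Q ds v i (blk Q ds i j *\<^sub>v v j) * alpha_path Q ds v (j # \<theta>)"
  unfolding alpha_path_def by (simp add: prod.lessThan_Suc_shift del: prod.lessThan_Suc)

lemma alpha_path_singleton:
  assumes "i \<in> {1..k}"
  shows "alpha_path Q ds v [i] = (\<Sum>b\<in>block ds i. blockwise ds u i b)"
  using coef_eq[OF assms, of "vec (ds i) (\<lambda>_. 1)"]
  by (simp add: alpha_path_def sum_block scalar_prod_def lessThan_atLeast0)

lemma coef_blk_mult:
  assumes i: "i \<in> {1..k}" and j: "j \<in> {1..k}"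
  shows "coef Q ds v i (blk Q ds i j *\<^sub>v v j) = \<rho>m * pbt.link i j"
proof -
  have blk: "blk Q ds i j \<in> carrier_mat (ds i) (ds j)" by (rule blk_carrier)
  have "coef Q ds v i (blk Q ds i j *\<^sub>v v j) = u i \<bullet> (blk Q ds i j *\<^sub>v v j)"
    using mult_mat_vec_carrier[OF blk v_carrier[OF j]] by (rule coef_eq[OF i])
  also have "\<dots> = (\<Sum>a<ds i. u i $ a * (\<Sum>b<ds j. blk Q ds i j $$ (a, b) * v j $ b))"
    using index_mult_mat_vec_sum[OF blk v_carrier[OF j]] blk
    by (simp add: scalar_prod_def lessThan_atLeast0 del: index_mult_mat_vec)
  also have "\<dots> = \<rho>m * pbt.link i j"
    using rho_max_pos by (simp add: pbt.link_def sum_block blk_def sum_distrib_left mult.assoc)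
  finally show ?thesis .
qed

lemma path_const_eq_alpha_path:
  assumes "\<theta> \<noteq> []" "set \<theta> \<subseteq> {1..k}"
  shows "\<rho>m ^ (length \<theta> - 1) * (pbt.path_const \<theta> * (\<Sum>b\<in>block ds (last \<theta>). blockwise ds u (last \<theta>) b))
    = alpha_path Q ds v \<theta> * (\<Prod>i\<leftarrow>\<theta>. block_mass i)"
  using assms
proof (induction \<theta> rule: induct_list012)
  case (2 i)
  then show ?case by (simp add: alpha_path_singleton)
next
  case (3 i j \<theta>)
  then show ?case by (simp add: alpha_path_Cons coef_blk_mult)
qed simp

lemma Hplus_Hminus_partition:
  assumes "set \<theta> \<subseteq> {1..k}" "rho_path Q ds \<theta> = \<rho>m"
  shows "Hplus Q ds \<theta> \<union> Hminus Q ds \<theta> = {..<length \<theta>}" "Hplus Q ds \<theta> \<inter> Hminus Q ds \<theta> = {}"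
    and "finite (Hplus Q ds \<theta>)" "finite (Hminus Q ds \<theta>)"
proof -
  have "\<rho> (\<theta> ! t) \<le> \<rho>m" if "t < length \<theta>" for t
    using assms(1) nth_mem[OF that] by (intro rho_le_max) auto
  then show "Hplus Q ds \<theta> \<union> Hminus Q ds \<theta> = {..<length \<theta>}"
    using assms(2) by (force simp: Hplus_def Hminus_def)
qed (auto simp: Hplus_def Hminus_def)

lemma prod_block_mass:
  assumes "set \<theta> \<subseteq> {1..k}" "rho_path Q ds \<theta> = \<rho>m"
  shows "(\<Prod>i\<leftarrow>\<theta>. block_mass i)
    = \<rho>m ^ card (Hminus Q ds \<theta>) * (\<Prod>t\<in>Hminus Q ds \<theta>. 1 / (\<rho>m - \<rho> (\<theta> ! t)))"
proof -
  note H = Hplus_Hminus_partition[OF assms]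
  have "(\<Prod>i\<leftarrow>\<theta>. block_mass i) = (\<Prod>t\<in>Hplus Q ds \<theta> \<union> Hminus Q ds \<theta>. block_mass (\<theta> ! t))"
    unfolding H(1) by (simp add: prod.list_conv_set_nth lessThan_atLeast0)
  also have "\<dots> = (\<Prod>t\<in>Hplus Q ds \<theta>. block_mass (\<theta> ! t)) * (\<Prod>t\<in>Hminus Q ds \<theta>. block_mass (\<theta> ! t))"
    using H(3,4,2) by (rule prod.union_disjoint)
  also have "(\<Prod>t\<in>Hplus Q ds \<theta>. block_mass (\<theta> ! t)) = 1"
    using assms(2) by (intro prod.neutral) (auto simp: Hplus_def block_mass_def)
  also have "(\<Prod>t\<in>Hminus Q ds \<theta>. block_mass (\<theta> ! t)) = (\<Prod>t\<in>Hminus Q ds \<theta>. \<rho>m * (1 / (\<rho>m - \<rho> (\<theta> ! t))))"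
    using assms(2) by (intro prod.cong) (auto simp: Hminus_def block_mass_def)
  finally show ?thesis by (simp only: prod.distrib prod_constant mult_1)
qed

lemma path_limit_eq_path_weight:
  assumes "\<theta> \<in> Pmax Q ds k"
  shows "pbt.path_limit (($) \<pi>) (\<lambda>_. 1) \<theta> = path_weight Q ds k \<pi> v \<theta> / \<rho>m ^ (hplus_max Q ds k - 1)"
proof -
  let ?K = "pbt.path_const \<theta> * (\<Sum>b\<in>block ds (last \<theta>). blockwise ds u (last \<theta>) b)"
  let ?W = "\<Prod>t\<in>Hminus Q ds \<theta>. 1 / (\<rho>m - \<rho> (\<theta> ! t))"
  have \<theta>: "\<theta> \<noteq> []" "set \<theta> \<subseteq> {1..k}" "rho_path Q ds \<theta> = \<rho>m" "card (Hplus Q ds \<theta>) = hplus_max Q ds k"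
    using assms by (auto simp: Pmax_def adm_paths_def admissible_def)
  have "hplus_max Q ds k \<noteq> 0" using hplus_max_pos assms by blast
  then have "length \<theta> - 1 = (hplus_max Q ds k - 1) + card (Hminus Q ds \<theta>)"
    using card_Un_disjoint[OF Hplus_Hminus_partition(3,4,2)[OF \<theta>(2,3)]] Hplus_Hminus_partition(1)[OF \<theta>(2,3)] \<theta>(4)
    by simp
  then have "\<rho>m ^ card (Hminus Q ds \<theta>) * (\<rho>m ^ (hplus_max Q ds k - 1) * ?K)
      = \<rho>m ^ card (Hminus Q ds \<theta>) * (alpha_path Q ds v \<theta> * ?W)"
    using path_const_eq_alpha_path[OF \<theta>(1,2)] unfolding prod_block_mass[OF \<theta>(2,3)]
    by (simp add: power_add ac_simps)
  then have "?K = alpha_path Q ds v \<theta> * ?W / \<rho>m ^ (hplus_max Q ds k - 1)"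
    using rho_max_pos by (simp add: eq_divide_eq mult.commute)
  then show ?thesis
    by (simp add: pbt.path_limit_def path_weight_def piv_eq mult.assoc)
qed

lemma alpha_path_nonneg:
  assumes "\<theta> \<noteq> []" "set \<theta> \<subseteq> {1..k}"
  shows "alpha_path Q ds v \<theta> \<ge> 0"
  using assms
proof (induction \<theta> rule: induct_list012)
  case (2 i)
  then show ?case
    by (auto simp: alpha_path_singleton sum_block intro!: sum_nonneg u_nonneg)
next
  case (3 i j \<theta>)
  have "pbt.link i j \<ge> 0"
    using 3 unfolding pbt.link_def sum_block
    by (auto intro!: sum_nonneg mult_nonneg_nonneg divide_nonneg_pos u_nonneg Q_nonneg off_add_less rho_max_pos
        less_imp_le[OF v_pos])
  then show ?case using 3 rho_max_pos by (simp add: alpha_path_Cons coef_blk_mult)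
qed simp

lemma
  assumes "\<theta> \<in> Pmax Q ds k" and \<pi>: "\<And>a. a < d \<Longrightarrow> \<pi> $ a \<ge> 0"
  shows path_weight_nonneg: "path_weight Q ds k \<pi> v \<theta> \<ge> 0"
    and path_weight_pos: "alpha_path Q ds v \<theta> \<noteq> 0 \<Longrightarrow> piv ds \<pi> v (hd \<theta>) \<noteq> 0 \<Longrightarrow> path_weight Q ds k \<pi> v \<theta> > 0"
proof -
  have \<theta>: "\<theta> \<noteq> []" "set \<theta> \<subseteq> {1..k}" "rho_path Q ds \<theta> = \<rho>m"
    using assms(1) by (auto simp: Pmax_def adm_paths_def admissible_def)
  have "hd \<theta> \<in> {1..k}" using \<theta> hd_in_set by blast
  then have "piv ds \<pi> v (hd \<theta>) \<ge> 0"
    unfolding piv_def by (intro sum_nonneg mult_nonneg_nonneg \<pi> off_add_less less_imp_le[OF v_pos]) auto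
  moreover have "alpha_path Q ds v \<theta> \<ge> 0" using \<theta>(1,2) by (rule alpha_path_nonneg)
  moreover have "(\<Prod>t\<in>Hminus Q ds \<theta>. 1 / (\<rho>m - \<rho> (\<theta> ! t))) > 0"
    using \<theta>(3) by (intro prod_pos) (auto simp: Hminus_def)
  ultimately show "path_weight Q ds k \<pi> v \<theta> \<ge> 0"
    and "alpha_path Q ds v \<theta> \<noteq> 0 \<Longrightarrow> piv ds \<pi> v (hd \<theta>) \<noteq> 0 \<Longrightarrow> path_weight Q ds k \<pi> v \<theta> > 0"
    by (simp_all add: path_weight_def)
qed

proposition cond_occupation_tendsto:
  assumes \<pi>: "\<And>a. a < d \<Longrightarrow> \<pi> $ a \<ge> 0"
    and pos: "\<exists>\<theta>\<in>Pmax Q ds k. alpha_path Q ds v \<theta> \<noteq> 0 \<and> piv ds \<pi> v (hd \<theta>) \<noteq> 0"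
    and l: "l \<in> {1..k}" "\<rho> l = \<rho>m" and t: "t < ds l"
  shows "(\<lambda>n. cond_occupation Q R \<pi> d n (Suc (off ds l + t))) \<longlonglongrightarrow>
     u l $ t * v l $ t * (1 / real (hplus_max Q ds k)) *
     ((\<Sum>\<theta>\<in>{\<theta> \<in> Pmax Q ds k. l \<in> set \<theta>}. path_weight Q ds k \<pi> v \<theta>) /
      (\<Sum>\<theta>\<in>Pmax Q ds k. path_weight Q ds k \<pi> v \<theta>))"
    (is "_ \<longlonglongrightarrow> ?uv * (1 / real ?h) * (?W\<^sub>l / ?W)")
proof -
  let ?s = "off ds l + t"
  obtain \<theta> where \<theta>: "\<theta> \<in> Pmax Q ds k" "alpha_path Q ds v \<theta> \<noteq> 0" "piv ds \<pi> v (hd \<theta>) \<noteq> 0"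
    using pos by blast
  then have ne: "Pmax Q ds k \<noteq> {}" by blast
  have "finite (Pmax Q ds k)" unfolding Pmax_eq[OF ne] using pbt.finite_paths by simp
  then have "?W > 0"
    using \<theta> \<pi> by (intro sum_pos2[of _ \<theta>] path_weight_pos path_weight_nonneg) auto
  have s: "?s \<in> block ds l" using t by (simp add: block_def)
  have states: "pbt.states = {..<d}" by (simp only: pbt.states_def UN_block_eq)
  have survival: "pole_growth ?h (?W / \<rho>m ^ (?h - 1)) (resolvent_form {..<d} scaled (($) \<pi>) (\<lambda>_. 1))"
    using pbt.resolvent_form_growth[OF path_ord_le[OF ne], where f = "($) \<pi>" and g = "\<lambda>_. 1"]
    by (simp add: states path_limit_eq_path_weight sum_divide_distrib flip: Pmax_eq[OF ne])
  have "{\<theta> \<in> pbt.paths. l \<in> set \<theta> \<and> pbt.path_ord \<theta> = ?h} = {\<theta> \<in> Pmax Q ds k. l \<in> set \<theta>}"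
    unfolding Pmax_eq[OF ne] by auto
  then have occupation: "pole_growth (Suc ?h) (?uv * (?W\<^sub>l / \<rho>m ^ (?h - 1)))
      (resolvent_form {..<d} scaled (($) \<pi>) (\<lambda>b. of_bool (b = ?s)) *
       resolvent_form {..<d} scaled (\<lambda>a. of_bool (a = ?s)) (\<lambda>_. 1))"
    using pbt.visit_growth[OF path_ord_le[OF ne] l(1) s, where f = "($) \<pi>" and g = "\<lambda>_. 1"] l(2)
    by (simp add: states path_limit_eq_path_weight sum_divide_distrib pole_ord_def block_mass_def)
  have "(\<lambda>n. cond_occupation Q R \<pi> d n (Suc ?s)) \<longlonglongrightarrow>
      ?uv * (?W\<^sub>l / \<rho>m ^ (?h - 1)) / (?W / \<rho>m ^ (?h - 1)) * (1 / real ?h)"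
    unfolding cond_occupation_eq_resolvent_forms[OF off_add_less[OF l(1) t] less_imp_neq[OF rho_max_pos, symmetric]]
    using hplus_max_pos[OF ne] \<open>?W > 0\<close> rho_max_pos
    by (intro pole_growth_quotient_tendsto[OF occupation survival]) auto
  also have "?uv * (?W\<^sub>l / \<rho>m ^ (?h - 1)) / (?W / \<rho>m ^ (?h - 1)) * (1 / real ?h)
      = ?uv * (1 / real ?h) * (?W\<^sub>l / ?W)"
    using rho_max_pos by simp
  finally show ?thesis .
qed

end

theorem theorem3p20:
  fixes d k :: nat and Q :: "real mat" and R \<pi> :: "real vec" and ds :: "nat \<Rightarrow> nat"
    and v :: "nat \<Rightarrow> real vec" and l s :: nat and ul vl :: "real vec"
  assumes d2: "d \<ge> 2"
    and Qc: "Q \<in> carrier_mat d d" and Rc: "R \<in> carrier_vec d" and pic: "\<pi> \<in> carrier_vec d"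
    and stoch: "\<forall>i<d. R $ i \<ge> 0 \<and> (\<forall>j<d. Q $$ (i,j) \<ge> 0) \<and> R $ i + (\<Sum>j<d. Q $$ (i,j)) = 1"
    and R0: "R \<noteq> 0\<^sub>v d" and Q0: "Q \<noteq> 0\<^sub>m d d"
    and eig: "\<forall>\<mu>. eigenvalue (cmat Q) \<mu> \<longrightarrow> cmod \<mu> < 1"
    and pi_dist: "(\<forall>i<d. \<pi> $ i \<ge> 0) \<and> (\<Sum>i<d. \<pi> $ i) = 1"
    and k1: "k \<ge> 1" and ds_pos: "\<forall>i\<in>{1..k}. ds i \<ge> 1" and ds_sum: "(\<Sum>i\<in>{1..k}. ds i) = d"
    and lower: "\<forall>i\<in>{1..k}. \<forall>j\<in>{1..k}. i < j \<longrightarrow> blk Q ds i j = 0\<^sub>m (ds i) (ds j)"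
    and evpos: "\<forall>i\<in>{1..k}. eventually_positive (blk Q ds i i)"
    and v_ok: "\<forall>i\<in>{1..k}. v i \<in> carrier_vec (ds i) \<and> (\<forall>a<ds i. v i $ a > 0) \<and>
                 blk Q ds i i *\<^sub>v v i = PF_eig Q ds i \<cdot>\<^sub>v v i \<and> (\<Sum>a<ds i. v i $ a) = 1"
    and A1: "\<forall>i\<in>{1..k}. PF_eig Q ds i < rho_max Q ds k \<longrightarrow> ds i = 1"
    and A2: "\<exists>\<theta>\<in>Pmax Q ds k. alpha_path Q ds v \<theta> \<noteq> 0 \<and> piv ds \<pi> v (hd \<theta>) \<noteq> 0"
    and lk: "l \<in> {1..k}" and l_max: "PF_eig Q ds l = rho_max Q ds k"
    and Pl: "{\<theta> \<in> Pmax Q ds k. l \<in> set \<theta>} \<noteq> {}"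
    and vl: "vl \<in> carrier_vec (ds l) \<and> (\<forall>a<ds l. vl $ a > 0) \<and>
             blk Q ds l l *\<^sub>v vl = PF_eig Q ds l \<cdot>\<^sub>v vl \<and> (\<Sum>a<ds l. vl $ a) = 1"
    and ul: "ul \<in> carrier_vec (ds l) \<and> (\<forall>a<ds l. ul $ a > 0) \<and>
             transpose_mat (blk Q ds l l) *\<^sub>v ul = PF_eig Q ds l \<cdot>\<^sub>v ul \<and> ul \<bullet> vl = 1"
    and s: "s \<in> {off ds l + 1 .. off ds l + ds l}"
  shows "(\<lambda>n. cond_occupation Q R \<pi> d n s) \<longlonglongrightarrow>
     ul $ (s - off ds l - 1) * vl $ (s - off ds l - 1) * (1 / real (hplus_max Q ds k)) *
     ((\<Sum>\<theta>\<in>{\<theta> \<in> Pmax Q ds k. l \<in> set \<theta>}. path_weight Q ds k \<pi> v \<theta>) /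
      (\<Sum>\<theta>\<in>Pmax Q ds k. path_weight Q ds k \<pi> v \<theta>))"
proof -
  interpret frobenius_form d k Q ds v
    by unfold_locales (use stoch k1 ds_pos ds_sum lower evpos v_ok A1 in auto)
  interpret block_l: perron_matrix "ds l" "blk Q ds l l" "\<rho> l" "v l"
    by (rule perron_block[OF lk])
  have v_eq: "vl = v l"
    using vl v_ok lk by (intro block_l.normalised_right_eigenvector_eq) auto
  have u_eq: "ul = u l"
    unfolding u_def using ul by (intro block_l.left_perron_eqI[symmetric]) (simp add: block_l.is_left_perron_def v_eq)
  define t where "t = s - off ds l - 1"
  have "t < ds l" and s_eq: "Suc (off ds l + t) = s"
    using s by (auto simp: t_def)
  then show ?thesis
    unfolding t_def[symmetric] u_eq v_eq
    using cond_occupation_tendsto[OF _ A2 lk l_max, of t R] pi_dist unfolding s_eq by blast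
qed

end
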